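(* Let $(z_n)_{n\in\mathbb{N}}$ be a sequence of distinct complex numbers in the unit disc $\mathbb{D}$. Assume that for some nondecreasing unbounded function $\psi\colon[1,+\infty)\to(0,+\infty)$ satisfying $\psi(2x)=O(\psi(x))$ as $x\to+\infty$ there is a constant $C_1>0$ such that $$N_{z_n}\Bigl(\frac{1-|z_n|}{2}\Bigr)\le C_1\,\psi\Bigl(\frac{1}{1-|z_n|}\Bigr)\quad\text{for all } n\in\mathbb{N}.$$ Then for any sequence $(b_n)$ of complex numbers for which there is $C_2>0$ with $$\ln|b_n|\le C_2\,\tilde\psi\Bigl(\frac{1}{1-|z_n|}\Bigr)\quad\text{for all } n\in\mathbb{N},$$ there exist an analytic function $f$ in $\mathbb{D}$ and a constant $C_3>0$ such that $f(z_n)=b_n$ for all $n\in\mathbb{N}$ and $$\ln M(r,f)\le C_3\,\tilde\psi\Bigl(\frac{1}{1-r}\Bigr)\quad\text{for all } r\in(0,1).$$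
   Context: $\mathbb{D}=\{z\in\mathbb{C}:|z|<1\}$. For $f$ analytic in $\mathbb{D}$ and $r\in(0,1)$, $M(r,f)=\max\{|f(z)|:|z|=r\}$. For a sequence $(z_k)$ in $\mathbb{D}$, $\zeta\in\mathbb{D}$ and $t\ge0$, $n_\zeta(t)$ is the number of members $z_k$ of the sequence with $|z_k-\zeta|\le t$, and $N_\zeta(r)=\int_0^r\frac{(n_\zeta(t)-1)^+}{t}\,dt$, where $x^+=\max\{x,0\}$. For a nondecreasing $\psi\colon[1,+\infty)\to(0,+\infty)$, $\tilde\psi(x)=\int_1^x\frac{\psi(t)}{t}\,dt$. Conventions: $\ln 0=-\infty$. *)

theory Defs
  imports "HOL-Analysis.Analysis" "HOL-Library.Landau_Symbols"
begin

(* Real logarithm with the convention ln 0 = -infinity (the library has ln 0 = 0). *)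
definition ln_ext :: "real \<Rightarrow> ereal" where
  "ln_ext x = (if x = 0 then -\<infinity> else ereal (ln x))"

(* For f continuous on the circle the supremum is attained, so it is the maximum. *)
definition max_mod :: "real \<Rightarrow> (complex \<Rightarrow> complex) \<Rightarrow> real" where
  "max_mod r f = (SUP w\<in>sphere 0 r. cmod (f w))"

(* Counts indices; the value is infinity if infinitely many members lie in the disc
   (card would give 0 there). *)
definition disc_count :: "(nat \<Rightarrow> complex) \<Rightarrow> complex \<Rightarrow> real \<Rightarrow> ennreal" where
  "disc_count z \<zeta> t = emeasure (count_space UNIV) {k. cmod (z k - \<zeta>) \<le> t}"

(* Subtraction on ennreal truncates at 0, so it is the positive part (n(t) - 1)^+.
   The integral takes the value infinity when it diverges. *)
definition disc_N :: "(nat \<Rightarrow> complex) \<Rightarrow> complex \<Rightarrow> real \<Rightarrow> ennreal" where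
  "disc_N z \<zeta> r = (\<integral>\<^sup>+t\<in>{0..r}. (disc_count z \<zeta> t - 1) / ennreal t \<partial>lborel)"

definition log_primitive :: "(real \<Rightarrow> real) \<Rightarrow> real \<Rightarrow> real" where
  "log_primitive \<psi> x = integral {1..x} (\<lambda>t. \<psi> t / t)"

end

theory Submission
  imports Defs "HOL-Complex_Analysis.Complex_Analysis"
begin

text \<open>Write \<open>G(u) = 1 + \<psi>~(1 / (1 - \<bar>u\<bar>))\<close>, where \<open>\<psi>~\<close> is the logarithmic primitive of \<open>\<psi>\<close>. Two consequences are
drawn from the hypothesis on the nodes. First, a disc of radius \<open>(1 - \<bar>z\<^sub>n\<bar>) / 4\<close> about \<open>z\<^sub>n\<close> contains
\<open>O(\<psi>(1 / (1 - \<bar>z\<^sub>n\<bar>)))\<close> nodes. Second, the product of the relative distances from \<open>z\<^sub>n\<close> to the nodes near it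
is not smaller than \<open>exp (- C \<psi>(1 / (1 - \<bar>z\<^sub>n\<bar>)))\<close>.

The interpolating function is a Lagrange type sum. Let \<open>w\<^sub>n(u) = (1 - \<bar>z\<^sub>n\<bar>\<^sup>2) / (1 - cnj z\<^sub>n u)\<close> be the kernel of
\<open>z\<^sub>n\<close>, \<open>E\<close> a Weierstrass factor of sufficiently high genus, \<open>p\<close> that genus plus 1, and \<open>P\<^sub>n\<close> the product of
\<open>E(w\<^sub>k(u))\<close> over \<open>k \<noteq> n\<close>. The terms are \<open>b\<^sub>n P\<^sub>n(u) / P\<^sub>n(z\<^sub>n)\<close> times a power of \<open>w\<^sub>n(u)\<close>. Everything rests on
the estimate that the sum of \<open>\<bar>w\<^sub>n(u)\<bar>\<^sup>p\<close> over all nodes is \<open>O(G(u))\<close> (\<open>kernel_sum_bound\<close>). It follows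
from the local count: the nodes are sorted into dyadic levels by their distance from the circle and into
square cells within a level. A level at distance \<open>h\<close> from the circle contributes
\<open>\<psi>(1 / h) min(1, h / (1 - \<bar>u\<bar>))\<^sup>q\<close>, and the sum of \<open>\<psi>\<close> over the levels with \<open>h \<ge> 1 - \<bar>u\<bar>\<close> is a Riemann
sum of \<open>\<psi>~(1 / (1 - \<bar>u\<bar>))\<close>. The finer levels are harmless by the doubling property.

As \<open>ln \<bar>E(w)\<bar>\<close> is at most a multiple of \<open>\<bar>w\<bar>\<^sup>p\<close>, this gives \<open>\<bar>P\<^sub>n(u)\<bar> \<le> exp (C G(u))\<close>
(\<open>omitted_product_le\<close>). At \<open>u = z\<^sub>n\<close> there is a matching lower bound \<open>exp (- C G(z\<^sub>n))\<close>
(\<open>omitted_product_at_own_node_ge\<close>): the only further loss comes from zeros close to \<open>z\<^sub>n\<close>, and the second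
consequence above controls it. The coefficients are thus at most \<open>exp (K G(z\<^sub>n))\<close>, and a power of \<open>w\<^sub>n\<close>
with exponent about \<open>2 K G(z\<^sub>n)\<close> reduces them to \<open>exp (C G(u))\<close> (\<open>peak_power_bound\<close>).

All constants are uniform over finite subfamilies of the nodes, so only finite sums and products are
formed and Montel's theorem supplies the interpolating function for all nodes (\<open>interpolation\<close>). Finally,
a node at the origin and the behaviour of the bound as \<open>r\<close> tends to 0, where \<open>\<psi>~(1 / (1 - r))\<close> vanishes,
are dealt with by writing \<open>f(u) = \<beta> + u g(u)\<close> with \<open>\<bar>\<beta>\<bar> \<le> 1\<close>.\<close>

section \<open>Doubling weights and their logarithmic primitives\<close>

lemma inverse_has_integral_ln:
  fixes x y :: real
  assumes "0 < x" "x \<le> y"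
  shows "((\<lambda>t. 1 / t) has_integral ln (y / x)) {x..y}"
proof -
  have "((\<lambda>t. 1 / t) has_integral (ln y - ln x)) {x..y}"
    using assms by (intro fundamental_theorem_of_calculus)
      (auto intro!: derivative_eq_intros simp: has_real_derivative_iff_has_vector_derivative[symmetric])
  thus ?thesis using assms by (simp add: ln_div)
qed

text \<open>A doubling constant near infinity extends to all of \<open>[1, \<infinity>)\<close>, because \<open>\<psi>\<close> is bounded above and away
from zero on compact intervals. The exponent \<open>q\<close>
records that \<open>\<psi>(x) = O(x\<^sup>q)\<close> with room to spare: a \<open>q\<close>-th power of a ratio of scales beats the growth
of \<open>\<psi>\<close> by a factor 2 at each dyadic step. It later fixes the genus of the canonical products.\<close>
locale doubling_weight =
  fixes \<psi> :: "real \<Rightarrow> real" and D :: real and q :: nat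
  assumes psi_pos: "1 \<le> x \<Longrightarrow> 0 < \<psi> x"
    and psi_mono: "1 \<le> x \<Longrightarrow> x \<le> y \<Longrightarrow> \<psi> x \<le> \<psi> y"
    and psi_doubling: "1 \<le> x \<Longrightarrow> \<psi> (2 * x) \<le> D * \<psi> x"
    and D_le_power: "2 * D \<le> 2 ^ q"
begin

text \<open>Adding 1 to the primitive, which vanishes at 1, lets additive constants be absorbed: the bounds for functions
on the disc all take the form \<open>exp (C * growth x)\<close>, and the additive constant in the exponent is removed only
at the very end.\<close>
definition growth :: "real \<Rightarrow> real" where
  "growth x = 1 + log_primitive \<psi> x"

lemma D_ge_1: "1 \<le> D"
proof -
  have "1 * \<psi> 1 \<le> D * \<psi> 1"
    using psi_mono[of 1 2] psi_doubling[of 1] by simp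
  thus ?thesis
    using psi_pos[of 1] by (meson order_refl mult_le_cancel_right_pos)
qed

text \<open>Since \<open>\<psi>\<close> is monotone and \<open>1 / t\<close> integrable, the second mean value theorem gives integrability of the
product.\<close>
lemma psi_over_integrable:
  assumes "1 \<le> x"
  shows "(\<lambda>t. \<psi> t / t) integrable_on {x..y}"
proof (cases "x \<le> y")
  case True
  have "(\<lambda>t. 1 / t) integrable_on {x..y}"
    using inverse_has_integral_ln[of x y] True assms by auto
  then obtain c where "((\<lambda>t. \<psi> t * (1 / t)) has_integral
      (\<psi> x * integral {x..c} (\<lambda>t. 1 / t) + \<psi> y * integral {c..y} (\<lambda>t. 1 / t))) {x..y}"
    using second_mean_value_theorem_full[of "\<lambda>t. 1 / t" x y \<psi>] True assms psi_mono
    by (metis order_trans)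
  thus ?thesis by auto
qed auto

lemma log_primitive_increment:
  assumes "1 \<le> x" "x \<le> y"
  shows "\<psi> x * ln (y / x) \<le> log_primitive \<psi> y - log_primitive \<psi> x"
    and "log_primitive \<psi> y - log_primitive \<psi> x \<le> \<psi> y * ln (y / x)"
proof -
  have *: "log_primitive \<psi> y - log_primitive \<psi> x = integral {x..y} (\<lambda>t. \<psi> t / t)"
    unfolding log_primitive_def
    using Henstock_Kurzweil_Integration.integral_combine[where a=1 and c=x and b=y and f="\<lambda>t. \<psi> t / t"] assms psi_over_integrable[of 1 y] by simp
  have I: "((\<lambda>t. c * (1 / t)) has_integral c * ln (y / x)) {x..y}" for c
    using inverse_has_integral_ln[of x y] assms by (intro has_integral_mult_right) auto
  have J: "((\<lambda>t. \<psi> t / t) has_integral integral {x..y} (\<lambda>t. \<psi> t / t)) {x..y}"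
    using psi_over_integrable[of x y] assms by (simp add: integrable_integral)
  show "\<psi> x * ln (y / x) \<le> log_primitive \<psi> y - log_primitive \<psi> x"
    unfolding * by (rule has_integral_le[OF I J]) (use assms psi_mono in \<open>auto simp: divide_right_mono\<close>)
  show "log_primitive \<psi> y - log_primitive \<psi> x \<le> \<psi> y * ln (y / x)"
    unfolding * by (rule has_integral_le[OF J I]) (use assms psi_mono in \<open>auto simp: divide_right_mono\<close>)
qed

lemma log_primitive_1 [simp]: "log_primitive \<psi> 1 = 0"
  by (simp add: log_primitive_def)

lemma log_primitive_ge_ln: "1 \<le> x \<Longrightarrow> \<psi> 1 * ln x \<le> log_primitive \<psi> x"
  using log_primitive_increment(1)[of 1 x] by simp

lemma log_primitive_mono:
  assumes "1 \<le> x" "x \<le> y"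
  shows "log_primitive \<psi> x \<le> log_primitive \<psi> y"
proof -
  have "0 \<le> \<psi> x * ln (y / x)"
    using assms psi_pos[of x] by simp
  thus ?thesis using log_primitive_increment(1)[OF assms] by linarith
qed

lemma growth_mono: "1 \<le> x \<Longrightarrow> x \<le> y \<Longrightarrow> growth x \<le> growth y"
  by (simp add: growth_def log_primitive_mono)

lemma growth_ge_1: "1 \<le> x \<Longrightarrow> 1 \<le> growth x"
  using log_primitive_mono[of 1 x] by (simp add: growth_def)

lemma log_primitive_double:
  assumes "1 \<le> x"
  shows "log_primitive \<psi> x + ln 2 * \<psi> x \<le> log_primitive \<psi> (2 * x)"
  using log_primitive_increment(1)[of x "2 * x"] assms by (simp add: mult.commute)

definition psi_const :: real where
  "psi_const = \<psi> 2 + D / ln 2"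

lemma psi_const_pos: "0 < psi_const"
  using psi_pos[of 2] D_ge_1 by (simp add: psi_const_def add_pos_nonneg)

text \<open>The primitive dominates the weight, because it collects at least \<open>\<psi>(x / 2) ln 2\<close> on \<open>[x / 2, x]\<close> and
\<open>\<psi>(x / 2)\<close> is comparable to \<open>\<psi>(x)\<close>.\<close>
lemma psi_le_growth:
  assumes "1 \<le> x"
  shows "\<psi> x \<le> psi_const * growth x"
proof -
  have "\<psi> x \<le> \<psi> 2 + D / ln 2 * log_primitive \<psi> x"
  proof (cases "x \<le> 2")
    case True
    have "0 \<le> D / ln 2 * log_primitive \<psi> x"
      using D_ge_1 log_primitive_mono[of 1 x] assms by simp
    thus ?thesis using psi_mono[OF assms True] by linarith
  next
    case False
    have "\<psi> x \<le> D * \<psi> (x / 2)" using psi_doubling[of "x / 2"] False by simp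
    also have "\<dots> = D / ln 2 * (ln 2 * \<psi> (x / 2))" by simp
    also have "\<dots> \<le> D / ln 2 * log_primitive \<psi> x"
      using log_primitive_double[of "x / 2"] log_primitive_mono[of 1 "x / 2"] False D_ge_1
      by (intro mult_left_mono) auto
    finally show ?thesis using psi_pos[of 2] by linarith
  qed
  also have "\<dots> \<le> psi_const * growth x"
  proof -
    define c where "c = D / ln 2"
    have "0 \<le> \<psi> 2 * log_primitive \<psi> x" "0 \<le> c"
      using D_ge_1 psi_pos[of 2] log_primitive_mono[of 1 x] assms by (auto simp: c_def)
    thus ?thesis by (simp add: psi_const_def growth_def algebra_simps flip: c_def)
  qed
  finally show ?thesis .
qed

lemma growth_quadruple:
  obtains C where "1 \<le> C" "\<And>x. 1 \<le> x \<Longrightarrow> growth (4 * x) \<le> C * growth x"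
proof
  define C where "C = 1 + D * D * psi_const * ln 4"
  have "0 \<le> D * D * psi_const * ln 4"
    using D_ge_1 psi_const_pos by simp
  thus "1 \<le> C" by (simp add: C_def)
  fix x :: real assume x: "1 \<le> x"
  have "\<psi> (4 * x) \<le> D * \<psi> (2 * x)"
    using psi_doubling[of "2 * x"] x by simp
  also have "\<dots> \<le> D * (D * \<psi> x)"
    using psi_doubling[OF x] D_ge_1 by simp
  also have "\<dots> \<le> D * (D * (psi_const * growth x))"
    using psi_le_growth[OF x] D_ge_1 by simp
  finally have "\<psi> (4 * x) * ln 4 \<le> D * (D * (psi_const * growth x)) * ln 4"
    by (intro mult_right_mono) auto
  moreover have "growth (4 * x) - growth x \<le> \<psi> (4 * x) * ln 4"
    using log_primitive_increment(2)[of x "4 * x"] x by (simp add: growth_def)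
  ultimately have "growth (4 * x) \<le> growth x + D * (D * (psi_const * growth x)) * ln 4"
    by linarith
  also have "\<dots> = C * growth x" by (simp add: C_def algebra_simps)
  finally show "growth (4 * x) \<le> C * growth x" .
qed

lemma sum_psi_powers_le: "ln 2 * (\<Sum>k<m. \<psi> (2 ^ k)) \<le> log_primitive \<psi> (2 ^ m)"
proof (induction m)
  case (Suc m)
  show ?case using Suc log_primitive_double[of "2 ^ m"] by (simp add: algebra_simps)
qed simp

lemma psi_power_shift: "\<psi> (2 ^ (m + i)) \<le> D ^ i * \<psi> (2 ^ m)"
proof (induction i)
  case (Suc i)
  have "\<psi> (2 ^ (m + Suc i)) \<le> D * \<psi> (2 ^ (m + i))"
    using psi_doubling[of "2 ^ (m + i)"] by simp
  also have "\<dots> \<le> D * (D ^ i * \<psi> (2 ^ m))"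
    using Suc D_ge_1 by (intro mult_left_mono) auto
  finally show ?case by simp
qed simp

lemma dyadic_level_exists:
  fixes x :: real
  assumes "1 \<le> x"
  obtains m :: nat where "2 ^ m \<le> x" "x < 2 ^ Suc m"
proof -
  define m where "m = nat \<lfloor>log 2 x\<rfloor>"
  have "0 \<le> log 2 x" using assms by simp
  hence m: "real m \<le> log 2 x" "log 2 x < real (Suc m)"
    unfolding m_def by linarith+
  have "2 ^ m \<le> x" using m(1) le_log_iff[of 2 x "real m"] assms by (simp add: powr_realpow)
  moreover have "x < 2 ^ Suc m"
    using m(2) log_less_iff[of 2 x "real (Suc m)"] assms powr_realpow[of 2 "Suc m"] by simp
  ultimately show ?thesis by (rule that)
qed

text \<open>Here the logarithmic primitive enters. With \<open>\<delta> = 1 - \<bar>u\<bar>\<close>, the \<open>k\<close>-th summand will be the contribution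
at the point \<open>u\<close> of the nodes at distance about \<open>2\<^sup>-\<^sup>k\<close> from the unit circle. The levels up to
\<open>2\<^sup>k = 1 / \<delta>\<close> form a Riemann sum for the integral of \<open>\<psi>(t) / t\<close>; beyond it the \<open>q\<close>-th power makes the
terms decay geometrically, so that they add up to a multiple of \<open>\<psi>(1 / \<delta>)\<close>.\<close>
lemma level_sum_bound:
  obtains C where "0 < C"
    "\<And>\<delta> K. 0 < \<delta> \<Longrightarrow> \<delta> \<le> 1 \<Longrightarrow> finite K \<Longrightarrow>
       (\<Sum>k\<in>K. \<psi> (2 ^ k) * min 1 ((1/2) ^ k / \<delta>) ^ q) \<le> C * growth (1 / \<delta>)"
proof
  define C where "C = (\<psi> 1 + D / ln 2) + 2 * D * psi_const"
  show "0 < C" using D_ge_1 psi_pos[of 1] psi_const_pos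
    by (simp add: C_def add_pos_nonneg)
  fix \<delta> :: real and K :: "nat set"
  assume \<delta>: "0 < \<delta>" "\<delta> \<le> 1" and K: "finite K"
  obtain m where m: "2 ^ m \<le> 1 / \<delta>" "1 / \<delta> < 2 ^ Suc m"
    using dyadic_level_exists[of "1 / \<delta>"] \<delta> by auto
  define t where "t k = \<psi> (2 ^ k) * min 1 ((1/2) ^ k / \<delta>) ^ q" for k
  have t_nonneg: "0 \<le> t k" for k
    using psi_pos[of "2 ^ k"] \<delta> by (auto simp: t_def intro!: mult_nonneg_nonneg)
  obtain B where B: "K \<subseteq> {..<Suc m + B}"
  proof -
    obtain N where "K \<subseteq> {..<N}" using K by (meson finite_nat_iff_bounded)
    thus ?thesis using that[of N] by force
  qed
  have L0: "0 \<le> log_primitive \<psi> (1 / \<delta>)"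
    using log_primitive_mono[of 1 "1 / \<delta>"] \<delta> by simp
  \<comment> \<open>Shifting the index by one step of doubling compares the sum with the lower Riemann sum of the
    integral.\<close>
  have "sum t {..<Suc m} \<le> (\<Sum>k<Suc m. \<psi> (2 ^ k))"
  proof (rule sum_mono)
    fix k
    have "min 1 ((1/2) ^ k / \<delta>) ^ q \<le> 1"
      using \<delta> by (intro power_le_one) auto
    from mult_left_mono[OF this, of "\<psi> (2 ^ k)"] psi_pos[of "2 ^ k"]
    show "t k \<le> \<psi> (2 ^ k)" by (simp add: t_def)
  qed
  also have "\<dots> = \<psi> 1 + (\<Sum>k<m. \<psi> (2 * 2 ^ k))"
    by (simp add: sum.lessThan_Suc_shift del: sum.lessThan_Suc)
  also have "(\<Sum>k<m. \<psi> (2 * 2 ^ k)) \<le> (\<Sum>k<m. D * \<psi> (2 ^ k))"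
    by (intro sum_mono psi_doubling) auto
  also have "\<psi> 1 + (\<Sum>k<m. D * \<psi> (2 ^ k)) = \<psi> 1 + D / ln 2 * (ln 2 * (\<Sum>k<m. \<psi> (2 ^ k)))"
    by (simp add: sum_distrib_left)
  also have "\<dots> \<le> \<psi> 1 + D / ln 2 * log_primitive \<psi> (1 / \<delta>)"
    using sum_psi_powers_le[of m] log_primitive_mono[of "2 ^ m" "1 / \<delta>"] m D_ge_1
    by (intro add_left_mono mult_left_mono) auto
  also have "\<dots> \<le> (\<psi> 1 + D / ln 2) * growth (1 / \<delta>)"
  proof -
    define c where "c = D / ln 2"
    have "0 \<le> \<psi> 1 * log_primitive \<psi> (1 / \<delta>)" "0 \<le> c"
      using L0 psi_pos[of 1] D_ge_1 by (auto simp: c_def)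
    thus ?thesis by (simp add: growth_def algebra_simps flip: c_def)
  qed
  finally have low: "sum t {..<Suc m} \<le> (\<psi> 1 + D / ln 2) * growth (1 / \<delta>)"
    by simp
  \<comment> \<open>The choice \<open>2 * D \<le> 2 ^ q\<close> makes the ratio of consecutive terms at most 1/2.\<close>
  have high_term: "t (Suc m + i) \<le> D * \<psi> (2 ^ m) * (1/2) ^ i" for i
  proof -
    have "(1/2) ^ (Suc m + i) / \<delta> = (1 / \<delta>) * (1/2) ^ (Suc m + i)" by simp
    also have "\<dots> \<le> 2 ^ Suc m * (1/2) ^ (Suc m + i)"
      using m by (intro mult_right_mono) auto
    also have "\<dots> = (1/2) ^ i"
      by (simp add: power_add power_one_over)
    finally have "min 1 ((1/2) ^ (Suc m + i) / \<delta>) ^ q \<le> ((1/2) ^ i) ^ q"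
      using \<delta> by (intro power_mono) auto
    moreover have "\<psi> (2 ^ (Suc m + i)) \<le> D ^ Suc i * \<psi> (2 ^ m)"
      using psi_power_shift[of m "Suc i"] by simp
    ultimately have "t (Suc m + i) \<le> (D ^ Suc i * \<psi> (2 ^ m)) * ((1/2) ^ i) ^ q"
      unfolding t_def using \<delta> D_ge_1 psi_pos[of "2 ^ m"] psi_pos[of "2 ^ (Suc m + i)"]
      by (intro mult_mono) auto
    also have "\<dots> = D * \<psi> (2 ^ m) * (D * (1/2) ^ q) ^ i"
      by (simp add: power_mult_distrib power_commutes flip: power_mult) (simp add: mult.commute)
    also have "\<dots> \<le> D * \<psi> (2 ^ m) * (1/2) ^ i"
      using D_le_power D_ge_1 psi_pos[of "2 ^ m"]
      by (intro mult_left_mono power_mono) (auto simp: field_simps)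
    finally show ?thesis .
  qed
  have "(\<Sum>i<B. t (Suc m + i)) \<le> (\<Sum>i<B. D * \<psi> (2 ^ m) * (1/2) ^ i)"
    by (intro sum_mono high_term)
  also have "\<dots> = D * \<psi> (2 ^ m) * (\<Sum>i<B. (1/2) ^ i)"
    by (simp add: sum_distrib_left)
  also have "\<dots> \<le> D * \<psi> (2 ^ m) * 2"
    using D_ge_1 psi_pos[of "2 ^ m"] by (intro mult_left_mono) (auto simp: sum_gp_strict)
  also have "\<dots> \<le> D * (psi_const * growth (1 / \<delta>)) * 2"
    using psi_mono[of "2 ^ m" "1 / \<delta>"] psi_le_growth[of "1 / \<delta>"] m D_ge_1 \<delta>
    by (intro mult_right_mono mult_left_mono) auto
  finally have high: "(\<Sum>i<B. t (Suc m + i)) \<le> 2 * D * psi_const * growth (1 / \<delta>)"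
    by (simp add: mult_ac)
  have "sum t K \<le> sum t {..<Suc m + B}"
    by (intro sum_mono2 B t_nonneg) auto
  also have "\<dots> = sum t {..<Suc m} + (\<Sum>i<B. t (Suc m + i))"
    by (induction B) (auto simp: algebra_simps)
  also have "\<dots> \<le> C * growth (1 / \<delta>)"
    using low high by (simp add: C_def algebra_simps)
  finally show "(\<Sum>k\<in>K. \<psi> (2 ^ k) * min 1 ((1/2) ^ k / \<delta>) ^ q) \<le> C * growth (1 / \<delta>)"
    by (simp add: t_def)
qed

end

section \<open>The kernel of a node\<close>

text \<open>As a function of \<open>u\<close> the kernel equals 1 at \<open>a\<close>, is bounded by 2 on the disc, and is small at points
far from \<open>a\<close> on the scale \<open>1 - \<bar>a\<bar>\<close>. So it serves both as the argument of the Weierstrass factors, which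
vanish exactly where the kernel is 1, and as a peak function at \<open>a\<close>.\<close>
definition disc_kernel :: "complex \<Rightarrow> complex \<Rightarrow> complex" where
  "disc_kernel a u = of_real (1 - (cmod a)\<^sup>2) / (1 - cnj a * u)"

text \<open>The third bound says that the pseudohyperbolic distance of two points of the disc is at most 1. It turns
Euclidean distances, which a square grid controls, into decay of the kernel.\<close>
lemma cmod_one_minus_cnj_mult_ge:
  assumes "cmod a < 1" "cmod u < 1"
  shows "1 - cmod u \<le> cmod (1 - cnj a * u)"
    and "1 - cmod a \<le> cmod (1 - cnj a * u)"
    and "cmod (a - u) \<le> cmod (1 - cnj a * u)"
proof -
  have "1 - cmod a * cmod u \<le> cmod (1 - cnj a * u)"
    using norm_triangle_ineq2[of 1 "cnj a * u"] by (simp add: norm_mult)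
  moreover have "cmod a * cmod u \<le> cmod u" "cmod a * cmod u \<le> cmod a"
    using assms by (auto simp: mult_left_le_one_le mult_right_le_one_le)
  ultimately show "1 - cmod u \<le> cmod (1 - cnj a * u)" "1 - cmod a \<le> cmod (1 - cnj a * u)"
    by linarith+
  have "(cmod (1 - cnj a * u))\<^sup>2 - (cmod (a - u))\<^sup>2 = (1 - (cmod a)\<^sup>2) * (1 - (cmod u)\<^sup>2)"
    unfolding cmod_power2 by (simp add: power2_eq_square algebra_simps)
  moreover have "0 \<le> (1 - (cmod a)\<^sup>2) * (1 - (cmod u)\<^sup>2)"
    using assms by (intro mult_nonneg_nonneg) (auto simp: power_le_one)
  ultimately have "(cmod (a - u))\<^sup>2 \<le> (cmod (1 - cnj a * u))\<^sup>2" by linarith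
  thus "cmod (a - u) \<le> cmod (1 - cnj a * u)"
    by (rule power2_le_imp_le) (rule norm_ge_zero)
qed

lemma one_minus_cnj_mult_nonzero:
  assumes "cmod a < 1" "cmod u < 1"
  shows "1 - cnj a * u \<noteq> 0"
proof
  assume "1 - cnj a * u = 0"
  hence "cmod (1 - cnj a * u) = 0" by (simp only: norm_zero)
  thus False using cmod_one_minus_cnj_mult_ge(1)[OF assms] assms by linarith
qed

lemma of_real_cmod_square: "(complex_of_real (cmod a))\<^sup>2 = a * cnj a"
  by (metis complex_norm_square of_real_power)

lemma disc_kernel_self:
  assumes "cmod a < 1"
  shows "disc_kernel a a = 1"
proof -
  have "complex_of_real (1 - (cmod a)\<^sup>2) = 1 - cnj a * a"
    by (simp only: of_real_diff of_real_power of_real_cmod_square of_real_1 mult.commute)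
  thus ?thesis
    unfolding disc_kernel_def using divide_self[OF one_minus_cnj_mult_nonzero[OF assms assms]]
    by (simp only:)
qed

text \<open>If \<open>a\<close> is not 0, the kernel takes the value 1 in the disc only at \<open>a\<close>; for \<open>a = 0\<close> it is constantly 1,
which is why a node at the origin has to be treated apart.\<close>
lemma one_minus_disc_kernel:
  assumes "cmod a < 1" "cmod u < 1"
  shows "1 - disc_kernel a u = cnj a * (a - u) / (1 - cnj a * u)"
proof -
  have "1 - disc_kernel a u = ((1 - cnj a * u) - of_real (1 - (cmod a)\<^sup>2)) / (1 - cnj a * u)"
    unfolding disc_kernel_def diff_divide_distrib[of "1 - cnj a * u"]
    using divide_self[OF one_minus_cnj_mult_nonzero[OF assms]] by (simp only:)
  also have "(1 - cnj a * u) - of_real (1 - (cmod a)\<^sup>2) = cnj a * (a - u)"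
    by (simp only: of_real_diff of_real_power of_real_cmod_square of_real_1)
      (simp add: algebra_simps)
  finally show ?thesis .
qed

lemma disc_kernel_holomorphic:
  assumes "cmod a < 1"
  shows "disc_kernel a holomorphic_on ball 0 1"
  unfolding disc_kernel_def using one_minus_cnj_mult_nonzero[OF assms]
  by (intro holomorphic_intros) auto

lemma cmod_disc_kernel_le:
  assumes "cmod a < 1" "cmod u < 1"
  shows "cmod (disc_kernel a u) \<le> 2 * (1 - cmod a) / cmod (1 - cnj a * u)"
proof -
  have "0 \<le> 1 - (cmod a)\<^sup>2" using assms by (simp add: power_le_one)
  hence "cmod (disc_kernel a u) = (1 - (cmod a)\<^sup>2) / cmod (1 - cnj a * u)"
    by (simp only: disc_kernel_def norm_divide norm_of_real abs_of_nonneg)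
  also have "1 - (cmod a)\<^sup>2 = (1 + cmod a) * (1 - cmod a)"
    by (simp add: power2_eq_square algebra_simps)
  also have "\<dots> \<le> 2 * (1 - cmod a)"
    using assms by (intro mult_right_mono) auto
  finally show ?thesis by (simp add: divide_right_mono)
qed

lemma cmod_disc_kernel_le_2:
  assumes "cmod a < 1" "cmod u < 1"
  shows "cmod (disc_kernel a u) \<le> 2"
proof -
  have "2 * (1 - cmod a) / cmod (1 - cnj a * u) \<le> 2"
    using cmod_one_minus_cnj_mult_ge(2)[OF assms] assms by (simp add: divide_le_eq)
  thus ?thesis using cmod_disc_kernel_le[OF assms] by linarith
qed

section \<open>Summing kernels over a sparse set of nodes\<close>

lemma sum_int_inverse_squares_le:
  assumes "finite A"
  shows "(\<Sum>a\<in>A. 1 / (1 + \<bar>real_of_int a\<bar>)\<^sup>2) \<le> 4"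
proof -
  have sym: "(\<Sum>a\<in>{- int N..int N}. 1 / (1 + \<bar>real_of_int a\<bar>)\<^sup>2) \<le> 4 - 2 / (real N + 1)" for N
  proof (induction N)
    case (Suc N)
    have "{- int (Suc N)..int (Suc N)} = insert (- int (Suc N)) (insert (int (Suc N)) {- int N..int N})"
      by auto
    hence "(\<Sum>a\<in>{- int (Suc N)..int (Suc N)}. 1 / (1 + \<bar>real_of_int a\<bar>)\<^sup>2)
         = 2 / (real N + 2)\<^sup>2 + (\<Sum>a\<in>{- int N..int N}. 1 / (1 + \<bar>real_of_int a\<bar>)\<^sup>2)"
      by (simp add: algebra_simps)
    also have "2 / (real N + 2)\<^sup>2 \<le> 2 / ((real N + 1) * (real N + 2))"
      by (intro divide_left_mono) (auto simp: power2_eq_square)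
    also have "2 / ((real N + 1) * (real N + 2)) = 2 / (real N + 1) - 2 / (real N + 2)"
      by (simp add: field_simps)
    finally show ?case using Suc by (simp add: algebra_simps)
  qed simp
  obtain N where N: "A \<subseteq> {- int N..int N}"
  proof -
    define b where "b = Max (abs ` A)"
    have b: "\<bar>a\<bar> \<le> b" if "a \<in> A" for a
      using assms that by (auto simp: b_def intro: Max_ge)
    have "A \<subseteq> {- int (nat b)..int (nat b)}"
    proof
      fix a assume "a \<in> A"
      from b[OF this] show "a \<in> {- int (nat b)..int (nat b)}" by auto
    qed
    thus ?thesis by (rule that)
  qed
  have "(\<Sum>a\<in>A. 1 / (1 + \<bar>real_of_int a\<bar>)\<^sup>2) \<le> (\<Sum>a\<in>{- int N..int N}. 1 / (1 + \<bar>real_of_int a\<bar>)\<^sup>2)"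
    by (intro sum_mono2 N) auto
  also have "\<dots> \<le> 4 - 2 / (real N + 1)" by (rule sym)
  also have "\<dots> \<le> 4" by simp
  finally show ?thesis .
qed

lemma sum_triple_product:
  fixes f :: "'a \<Rightarrow> real" and g :: "'b \<Rightarrow> real" and h :: "'c \<Rightarrow> real"
  shows "(\<Sum>(k, a, b)\<in>K \<times> A \<times> B. f k * (g a * h b)) = sum f K * (sum g A * sum h B)"
proof -
  have "(\<Sum>(k, a, b)\<in>K \<times> A \<times> B. f k * (g a * h b)) = (\<Sum>(k, c)\<in>K \<times> (A \<times> B). f k * (case c of (a, b) \<Rightarrow> g a * h b))"
    by (intro sum.cong) auto
  also have "\<dots> = sum f K * (\<Sum>(a, b)\<in>A \<times> B. g a * h b)"
    by (simp add: sum_product sum.cartesian_product)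
  also have "(\<Sum>(a, b)\<in>A \<times> B. g a * h b) = sum g A * sum h B"
    by (simp add: sum_product sum.cartesian_product)
  finally show ?thesis .
qed

text \<open>A bound for the logarithmic sum on the right is the form in which the hypothesis on the integrated
counting function is used; in particular it limits the number of nodes close to \<open>c\<close>.\<close>
lemma card_mult_ln2_le_log_sum:
  assumes "\<And>k. k \<in> F \<Longrightarrow> z k \<noteq> c" "\<And>k. k \<in> F \<Longrightarrow> 2 * cmod (z k - c) \<le> d"
  shows "real (card F) * ln 2 \<le> (\<Sum>k\<in>F. max 0 (ln (d / cmod (z k - c))))"
proof -
  have "(\<Sum>k\<in>F. ln 2) \<le> (\<Sum>k\<in>F. max 0 (ln (d / cmod (z k - c))))"
  proof (rule sum_mono)
    fix k assume "k \<in> F"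
    hence "2 \<le> d / cmod (z k - c)" using assms[of k] by (simp add: le_divide_eq)
    hence "ln 2 \<le> ln (d / cmod (z k - c))" by (subst ln_le_cancel_iff) auto
    thus "ln 2 \<le> max 0 (ln (d / cmod (z k - c)))" by linarith
  qed
  thus ?thesis by simp
qed

text \<open>The index set \<open>I\<close> is there to leave out a node at the origin; the other nodes stay away from it, hence
\<open>\<eta>\<close>. The crowding axiom is the hypothesis on the integrated counting function, with the integral
evaluated: each node \<open>z\<^sub>k\<close> contributes the integral of \<open>1 / t\<close> over \<open>[\<bar>z\<^sub>k - z\<^sub>m\<bar>, (1 - \<bar>z\<^sub>m\<bar>) / 2]\<close>.\<close>
locale sparse_points = doubling_weight +
  fixes z :: "nat \<Rightarrow> complex" and I :: "nat set" and \<eta> C\<^sub>1 :: real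
  assumes in_disc: "n \<in> I \<Longrightarrow> cmod (z n) < 1"
    and eta_pos: "0 < \<eta>"
    and eta_le: "n \<in> I \<Longrightarrow> \<eta> \<le> cmod (z n)"
    and inj_z: "inj_on z I"
    and C1_pos: "0 < C\<^sub>1"
    and crowding: "m \<in> I \<Longrightarrow> finite F \<Longrightarrow> F \<subseteq> I - {m} \<Longrightarrow>
      (\<Sum>k\<in>F. max 0 (ln ((1 - cmod (z m)) / 2 / cmod (z k - z m)))) \<le> C\<^sub>1 * \<psi> (1 / (1 - cmod (z m)))"
begin

lemma card_close_points_le:
  assumes m: "m \<in> I" and F: "finite F" "F \<subseteq> I"
    and close: "\<And>n. n \<in> F \<Longrightarrow> cmod (z n - z m) \<le> (1 - cmod (z m)) / 4"
  shows "real (card F) \<le> (1 / \<psi> 1 + C\<^sub>1 / ln 2) * \<psi> (1 / (1 - cmod (z m)))"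
proof -
  have one: "\<psi> 1 \<le> \<psi> (1 / (1 - cmod (z m)))"
    using in_disc[OF m] by (intro psi_mono) (auto simp: field_simps)
  have "real (card (F - {m})) * ln 2
      \<le> (\<Sum>k\<in>F - {m}. max 0 (ln ((1 - cmod (z m)) / 2 / cmod (z k - z m))))"
  proof (rule card_mult_ln2_le_log_sum)
    fix k assume k: "k \<in> F - {m}"
    thus "z k \<noteq> z m" using inj_z F m by (auto dest: inj_onD)
    show "2 * cmod (z k - z m) \<le> (1 - cmod (z m)) / 2" using close[of k] k by simp
  qed
  also have "\<dots> \<le> C\<^sub>1 * \<psi> (1 / (1 - cmod (z m)))"
    using F by (intro crowding m) auto
  finally have "real (card (F - {m})) \<le> C\<^sub>1 / ln 2 * \<psi> (1 / (1 - cmod (z m)))"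
    by (simp add: field_simps)
  moreover have "card F \<le> Suc (card (F - {m}))"
    using F by (simp add: card_Diff_singleton_if) arith
  moreover have "1 \<le> 1 / \<psi> 1 * \<psi> (1 / (1 - cmod (z m)))"
    using one psi_pos[of 1] by (simp add: field_simps)
  ultimately show ?thesis by (simp add: distrib_right)
qed

text \<open>The point is to bound one kernel power by a product of a factor depending only on the level of \<open>a\<close> and
of factors depending only on the two grid coordinates of \<open>a\<close> relative to \<open>u\<close>, at the scale of that
level. The \<open>q\<close> powers pay for the growth of \<open>\<psi>\<close> at fine levels; the remaining four, two for each
coordinate, make the sum over the planar grid converge.\<close>
lemma kernel_term_le:
  assumes a: "cmod a < 1" and u: "cmod u < 1" and k: "2 ^ k \<le> 1 / (1 - cmod a)" "1 / (1 - cmod a) < 2 ^ Suc k"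
  shows "cmod (disc_kernel a u) ^ (q + 4) \<le> 4 ^ q * 96 ^ 4 *
    (min 1 ((1/2) ^ k / (1 - cmod u)) ^ q *
      (1 / (1 + \<bar>real_of_int \<lfloor>16 * 2 ^ k * Re (a - u)\<rfloor>\<bar>)\<^sup>2 *
       (1 / (1 + \<bar>real_of_int \<lfloor>16 * 2 ^ k * Im (a - u)\<rfloor>\<bar>)\<^sup>2)))"
proof -
  define h :: real where "h = (1/2) ^ k"
  define R where "R = cmod (1 - cnj a * u)"
  define w where "w = cmod (disc_kernel a u)"
  have h0: "0 < h" and hp: "2 ^ k * h = 1" by (auto simp: h_def power_one_over)
  have ha: "1 - cmod a \<le> h" "h / 2 \<le> 1 - cmod a"
    using k a by (auto simp: h_def field_simps power_one_over)
  have R: "1 - cmod u \<le> R" "h / 2 \<le> R" "cmod (a - u) \<le> R"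
    using cmod_one_minus_cnj_mult_ge[OF a u] ha by (auto simp: R_def)
  have R0: "0 < R" using R(2) h0 by linarith
  have w: "w \<le> 2 * h / R"
  proof -
    have "w \<le> 2 * (1 - cmod a) / R" using cmod_disc_kernel_le[OF a u] by (simp add: w_def R_def)
    also have "\<dots> \<le> 2 * h / R" using ha R0 by (intro divide_right_mono) auto
    finally show ?thesis .
  qed
  have w0: "0 \<le> w" by (simp add: w_def)
  have m0: "0 \<le> min 1 (h / (1 - cmod u))" using h0 u by auto
  have far: "w \<le> 4 * min 1 (h / (1 - cmod u))"
  proof -
    have "2 * h / R \<le> 4" using R(2) R0 by (simp add: divide_le_eq)
    moreover have "2 * h / R \<le> 2 * h / (1 - cmod u)"
      using R u h0 R0 by (intro divide_left_mono) auto
    moreover have "0 \<le> h / (1 - cmod u)" using h0 u by simp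
    ultimately show ?thesis using w by (auto simp: min_def)
  qed
  \<comment> \<open>The bounds \<open>h / 2 \<le> R\<close> and \<open>cmod (a - u) \<le> R\<close> combine to \<open>h + \<bar>x\<bar> \<le> 3 * R\<close>, and \<open>\<bar>x\<bar>\<close> is the grid coordinate times \<open>h / 16\<close>
  up to one unit of rounding.\<close>
  have near: "w \<le> 96 * (1 / (1 + \<bar>real_of_int \<lfloor>16 * 2 ^ k * x\<rfloor>\<bar>))" if "\<bar>x\<bar> \<le> cmod (a - u)" for x
  proof -
    have "\<bar>real_of_int \<lfloor>16 * 2 ^ k * x\<rfloor>\<bar> \<le> 1 + \<bar>16 * 2 ^ k * x\<bar>" by linarith
    hence "h * (1 + \<bar>real_of_int \<lfloor>16 * 2 ^ k * x\<rfloor>\<bar>) \<le> h * (2 + 16 * 2 ^ k * \<bar>x\<bar>)"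
      using h0 by (intro mult_left_mono) (auto simp: abs_mult)
    also have "\<dots> = 2 * h + 16 * (2 ^ k * h) * \<bar>x\<bar>" by (simp add: algebra_simps)
    also have "\<dots> \<le> 48 * R" using that R h0 by (simp add: hp)
    finally have "2 * h / R \<le> 96 * (1 / (1 + \<bar>real_of_int \<lfloor>16 * 2 ^ k * x\<rfloor>\<bar>))"
      using R0 by (simp add: field_simps)
    thus ?thesis using w by linarith
  qed
  have "w ^ (q + 4) = w ^ q * (w\<^sup>2 * w\<^sup>2)" by (simp add: power_add power2_eq_square power4_eq_xxxx)
  also have "\<dots> \<le> (4 * min 1 (h / (1 - cmod u))) ^ q *
      ((96 * (1 / (1 + \<bar>real_of_int \<lfloor>16 * 2 ^ k * Re (a - u)\<rfloor>\<bar>)))\<^sup>2 *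
       (96 * (1 / (1 + \<bar>real_of_int \<lfloor>16 * 2 ^ k * Im (a - u)\<rfloor>\<bar>)))\<^sup>2)"
    using w0 m0 far near[OF abs_Re_le_cmod] near[OF abs_Im_le_cmod]
    by (intro mult_mono power_mono) auto
  also have "\<dots> = 4 ^ q * 96 ^ 4 * (min 1 (h / (1 - cmod u)) ^ q *
      (1 / (1 + \<bar>real_of_int \<lfloor>16 * 2 ^ k * Re (a - u)\<rfloor>\<bar>)\<^sup>2 *
       (1 / (1 + \<bar>real_of_int \<lfloor>16 * 2 ^ k * Im (a - u)\<rfloor>\<bar>)\<^sup>2)))"
  proof -
    have "(4 * m) ^ q * ((96 * (1 / x))\<^sup>2 * (96 * (1 / y))\<^sup>2)
        = 4 ^ q * 96 ^ 4 * (m ^ q * (1 / x\<^sup>2 * (1 / y\<^sup>2)))" for m x y :: real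
      by (simp add: power_mult_distrib power_divide)
    thus ?thesis .
  qed
  finally show ?thesis by (simp only: w_def h_def)
qed

definition level :: "nat \<Rightarrow> nat" where
  "level n = (SOME k. 2 ^ k \<le> 1 / (1 - cmod (z n)) \<and> 1 / (1 - cmod (z n)) < 2 ^ Suc k)"

lemma level_bounds:
  assumes "n \<in> I"
  shows "2 ^ level n \<le> 1 / (1 - cmod (z n))" "1 / (1 - cmod (z n)) < 2 ^ Suc (level n)"
proof -
  have "1 \<le> 1 / (1 - cmod (z n))" using in_disc[OF assms] by (simp add: field_simps)
  then obtain k where "2 ^ k \<le> 1 / (1 - cmod (z n))" "1 / (1 - cmod (z n)) < 2 ^ Suc k"
    by (rule dyadic_level_exists)
  hence "\<exists>k. 2 ^ k \<le> 1 / (1 - cmod (z n)) \<and> 1 / (1 - cmod (z n)) < 2 ^ Suc k" by blast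
  from someI_ex[OF this] show "2 ^ level n \<le> 1 / (1 - cmod (z n))" "1 / (1 - cmod (z n)) < 2 ^ Suc (level n)"
    by (auto simp: level_def)
qed

text \<open>Cells at level \<open>k\<close> are squares of side \<open>2\<^sup>-\<^sup>k / 16\<close>, small enough for two nodes of the same level in one
cell to count as close in the sense of the crowding bound.\<close>
definition cell :: "complex \<Rightarrow> nat \<Rightarrow> nat \<times> int \<times> int" where
  "cell u n = (level n, \<lfloor>16 * 2 ^ level n * Re (z n - u)\<rfloor>, \<lfloor>16 * 2 ^ level n * Im (z n - u)\<rfloor>)"

lemma same_cell_close:
  assumes "n \<in> I" "m \<in> I" "cell u n = cell u m"
  shows "cmod (z n - z m) \<le> (1 - cmod (z m)) / 4"
proof -
  define k where "k = level m"
  have k: "level n = k" using assms by (simp add: cell_def k_def)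
  have close: "\<bar>x - y\<bar> \<le> (1/2) ^ k / 16" if "\<lfloor>16 * 2 ^ k * x\<rfloor> = \<lfloor>16 * 2 ^ k * y\<rfloor>" for x y :: real
  proof -
    have "\<bar>16 * 2 ^ k * x - 16 * 2 ^ k * y\<bar> \<le> 1" using that by linarith
    also have "16 * 2 ^ k * x - 16 * 2 ^ k * y = 16 * 2 ^ k * (x - y)" by (simp add: algebra_simps)
    finally have "16 * 2 ^ k * \<bar>x - y\<bar> \<le> 1" by (simp add: abs_mult)
    hence "\<bar>x - y\<bar> \<le> 1 / (16 * 2 ^ k)" by (simp add: pos_le_divide_eq mult.commute)
    thus ?thesis by (simp add: power_one_over)
  qed
  have "\<bar>Re (z n - u) - Re (z m - u)\<bar> \<le> (1/2) ^ k / 16" "\<bar>Im (z n - u) - Im (z m - u)\<bar> \<le> (1/2) ^ k / 16"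
    using assms(3) by (intro close; simp add: cell_def k k_def[symmetric])+
  hence "cmod (z n - z m) \<le> (1/2) ^ k / 16 + (1/2) ^ k / 16"
    using cmod_le[of "z n - z m"] by simp
  moreover have "(1/2) ^ k \<le> 2 * (1 - cmod (z m))"
    using level_bounds(2)[OF assms(2)] in_disc[OF assms(2)]
    by (simp add: k_def field_simps power_one_over)
  ultimately show ?thesis by linarith
qed

text \<open>By the crowding bound a cell of level \<open>k\<close> holds \<open>O(\<psi>(2\<^sup>k))\<close> nodes. Grouping the nodes by cells and
majorising cell by cell leaves a product of two convergent sums over the integers and of the dyadic
sum over levels. Counting squares in the whole plane instead of those meeting a thin annulus is wasteful,
but the surplus powers of the kernel make up for it.\<close>
lemma kernel_sum_bound:
  obtains C where "0 < C"
    "\<And>u F. cmod u < 1 \<Longrightarrow> finite F \<Longrightarrow> F \<subseteq> I \<Longrightarrow>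
      (\<Sum>n\<in>F. cmod (disc_kernel (z n) u) ^ (q + 4)) \<le> C * growth (1 / (1 - cmod u))"
proof -
  obtain C0 where C0: "0 < C0" and level_sum: "\<And>\<delta> K. 0 < \<delta> \<Longrightarrow> \<delta> \<le> 1 \<Longrightarrow> finite K \<Longrightarrow>
       (\<Sum>k\<in>K. \<psi> (2 ^ k) * min 1 ((1/2) ^ k / \<delta>) ^ q) \<le> C0 * growth (1 / \<delta>)"
    using level_sum_bound by blast
  define M where "M = 1 / \<psi> 1 + C\<^sub>1 / ln 2"
  have M: "0 < M" using psi_pos[of 1] C1_pos by (simp add: M_def add_pos_pos)
  define A :: real where "A = 4 ^ q * 96 ^ 4"
  have A: "0 < A" by (simp add: A_def)
  show ?thesis
  proof (rule that)
    show "0 < A * (M * D) * (C0 * 16)" using A M D_ge_1 C0 by simp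
    fix u F assume u: "cmod u < 1" and F: "finite F" "F \<subseteq> I"
    define \<delta> where "\<delta> = 1 - cmod u"
    define f where "f k = min 1 ((1/2) ^ k / \<delta>) ^ q" for k :: nat
    define g where "g a = 1 / (1 + \<bar>real_of_int a\<bar>)\<^sup>2" for a
    define v where "v \<kappa> = (case \<kappa> of (k, a, b) \<Rightarrow> f k * (g a * g b))" for \<kappa>
    have \<delta>: "0 < \<delta>" "\<delta> \<le> 1" using u by (auto simp: \<delta>_def)
    have f0: "0 \<le> f k" for k using \<delta> by (simp add: f_def)
    have g0: "0 \<le> g a" for a by (simp add: g_def)
    have v0: "0 \<le> v \<kappa>" for \<kappa> by (auto simp: v_def f0 g0 split: prod.split)
    define K where "K = fst ` cell u ` F"
    define P where "P = (fst \<circ> snd) ` cell u ` F"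
    define Q where "Q = (snd \<circ> snd) ` cell u ` F"
    have fin: "finite K" "finite P" "finite Q" using F by (auto simp: K_def P_def Q_def)
    have sub: "cell u ` F \<subseteq> K \<times> P \<times> Q"
      by (auto simp: K_def P_def Q_def cell_def image_image)
    have fibre: "real (card {n \<in> F. cell u n = \<kappa>}) \<le> M * D * \<psi> (2 ^ fst \<kappa>)" if \<kappa>: "\<kappa> \<in> cell u ` F" for \<kappa>
    proof -
      obtain m where m: "m \<in> F" "\<kappa> = cell u m" using \<kappa> by blast
      hence mI: "m \<in> I" using F by blast
      have "real (card {n \<in> F. cell u n = \<kappa>}) \<le> M * \<psi> (1 / (1 - cmod (z m)))"
        unfolding M_def using F m mI same_cell_close[of _ m u]
        by (intro card_close_points_le) auto
      also have "\<psi> (1 / (1 - cmod (z m))) \<le> \<psi> (2 * 2 ^ level m)"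
        using level_bounds[OF mI] in_disc[OF mI] by (intro psi_mono) (auto simp: field_simps)
      also have "\<dots> \<le> D * \<psi> (2 ^ level m)" by (intro psi_doubling) auto
      finally show ?thesis using M m by (simp add: cell_def mult_ac)
    qed
    have "(\<Sum>n\<in>F. cmod (disc_kernel (z n) u) ^ (q + 4)) \<le> (\<Sum>n\<in>F. A * v (cell u n))"
    proof (rule sum_mono)
      fix n assume "n \<in> F"
      hence "n \<in> I" using F by blast
      from kernel_term_le[OF in_disc[OF this] u level_bounds[OF this]]
      show "cmod (disc_kernel (z n) u) ^ (q + 4) \<le> A * v (cell u n)"
        by (simp add: A_def v_def cell_def f_def g_def \<delta>_def)
    qed
    also have "\<dots> = A * (\<Sum>n\<in>F. v (cell u n))" by (simp add: sum_distrib_left)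
    also have "(\<Sum>n\<in>F. v (cell u n)) = (\<Sum>\<kappa>\<in>cell u ` F. \<Sum>n | n \<in> F \<and> cell u n = \<kappa>. v (cell u n))"
      by (rule sum.image_gen[OF F(1)])
    also have "\<dots> = (\<Sum>\<kappa>\<in>cell u ` F. real (card {n \<in> F. cell u n = \<kappa>}) * v \<kappa>)"
      by (intro sum.cong) auto
    also have "\<dots> \<le> (\<Sum>\<kappa>\<in>cell u ` F. M * D * \<psi> (2 ^ fst \<kappa>) * v \<kappa>)"
      by (intro sum_mono mult_right_mono fibre v0)
    also have "\<dots> \<le> (\<Sum>\<kappa>\<in>K \<times> P \<times> Q. M * D * \<psi> (2 ^ fst \<kappa>) * v \<kappa>)"
      using M D_ge_1 by (intro sum_mono2 sub)
        (auto simp: fin intro!: mult_nonneg_nonneg v0 less_imp_le[OF psi_pos])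
    also have "\<dots> = (\<Sum>\<kappa>\<in>K \<times> P \<times> Q. M * D * (case \<kappa> of (k, a, b) \<Rightarrow> \<psi> (2 ^ k) * f k * (g a * g b)))"
      by (intro sum.cong) (auto simp: v_def)
    also have "\<dots> = M * D * ((\<Sum>k\<in>K. \<psi> (2 ^ k) * f k) * (sum g P * sum g Q))"
      unfolding sum_distrib_left[symmetric] sum_triple_product ..
    also have "\<dots> \<le> M * D * ((C0 * growth (1 / \<delta>)) * (4 * 4))"
    proof -
      have "sum g P \<le> 4" "sum g Q \<le> 4"
        using sum_int_inverse_squares_le fin by (auto simp: g_def)
      moreover have "(\<Sum>k\<in>K. \<psi> (2 ^ k) * f k) \<le> C0 * growth (1 / \<delta>)"
        unfolding f_def by (rule level_sum) (use \<delta> fin in auto)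
      moreover have "0 \<le> C0 * growth (1 / \<delta>)"
        using C0 growth_ge_1[of "1 / \<delta>"] \<delta> by simp
      moreover have "0 \<le> sum g P" "0 \<le> sum g Q" by (auto intro: sum_nonneg g0)
      ultimately show ?thesis using M D_ge_1 by (intro mult_left_mono mult_mono) auto
    qed
    finally show "(\<Sum>n\<in>F. cmod (disc_kernel (z n) u) ^ (q + 4)) \<le> A * (M * D) * (C0 * 16) * growth (1 / (1 - cmod u))"
      using A by (simp add: \<delta>_def mult_ac)
  qed
qed

end

section \<open>Two-sided bounds for Weierstrass factors\<close>

definition exponent_bound :: "nat \<Rightarrow> real" where
  "exponent_bound s = (\<Sum>k=1..s. 2 ^ k)"

lemma exponent_bound_nonneg: "0 \<le> exponent_bound s"
  by (simp add: exponent_bound_def sum_nonneg)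

lemma cmod_weierstrass_exponent_le:
  assumes "cmod w \<le> 2"
  shows "cmod (\<Sum>k=1..s. w ^ k / of_nat k) \<le> exponent_bound s"
  unfolding exponent_bound_def
proof (rule sum_norm_le)
  fix k assume k: "k \<in> {1..s}"
  have "cmod (w ^ k / of_nat k) = cmod w ^ k / real k"
    by (simp add: norm_divide norm_power)
  also have "\<dots> \<le> cmod w ^ k / 1"
    using k by (intro divide_left_mono) auto
  also have "\<dots> \<le> 2 ^ k" using power_mono[OF assms, of k] by simp
  finally show "cmod (w ^ k / of_nat k) \<le> 2 ^ k" .
qed

lemma one_le_scaled_power:
  fixes x :: real
  assumes "1 / 2 \<le> x"
  shows "1 \<le> 2 ^ n * x ^ n"
  using one_le_power[of "2 * x" n] assms by (simp add: power_mult_distrib)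

text \<open>A single power of \<open>\<bar>w\<bar>\<close> covers both regimes: for small \<open>w\<close> the factor differs from 1 by \<open>O(\<bar>w\<bar>\<^sup>s\<^sup>+\<^sup>1)\<close>, while
for \<open>1/2 \<le> \<bar>w\<bar> \<le> 2\<close> everything is bounded and \<open>2\<^sup>s\<^sup>+\<^sup>1 \<bar>w\<bar>\<^sup>s\<^sup>+\<^sup>1 \<ge> 1\<close> absorbs the constants.\<close>
lemma cmod_weierstrass_factor_le:
  assumes "cmod w \<le> 2"
  shows "cmod (weierstrass_factor s w) \<le> exp ((3 + 2 ^ Suc s * (exponent_bound s + 2)) * cmod w ^ Suc s)"
proof (cases "cmod w \<le> 1 / 2")
  case True
  have "cmod (weierstrass_factor s w) \<le> 1 + cmod (weierstrass_factor s w - 1)"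
    using norm_triangle_ineq[of 1 "weierstrass_factor s w - 1"] by simp
  also have "\<dots> \<le> 1 + 3 * cmod w ^ Suc s"
    using weierstrass_factor_bound[OF True, of s] by simp
  also have "\<dots> \<le> exp (3 * cmod w ^ Suc s)" by (rule exp_ge_add_one_self)
  also have "\<dots> \<le> exp ((3 + 2 ^ Suc s * (exponent_bound s + 2)) * cmod w ^ Suc s)"
    unfolding exp_le_cancel_iff using exponent_bound_nonneg[of s] by (intro mult_right_mono) auto
  finally show ?thesis .
next
  case False
  have "cmod (weierstrass_factor s w) = cmod (1 - w) * exp (Re (\<Sum>k=1..s. w ^ k / of_nat k))"
    by (simp only: weierstrass_factor_def norm_mult norm_exp_eq_Re)
  also have "\<dots> \<le> 3 * exp (exponent_bound s)"
    using norm_triangle_ineq4[of 1 w] assms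
      order_trans[OF complex_Re_le_cmod cmod_weierstrass_exponent_le[OF assms, of s]]
    by (intro mult_mono) auto
  also have "\<dots> \<le> exp 2 * exp (exponent_bound s)"
    using exp_ge_add_one_self[of 2] by (intro mult_right_mono) auto
  also have "\<dots> = exp (1 * (exponent_bound s + 2))" by (simp add: exp_add)
  also have "\<dots> \<le> exp ((2 ^ Suc s * cmod w ^ Suc s) * (exponent_bound s + 2))"
    unfolding exp_le_cancel_iff
    using one_le_scaled_power[of "cmod w" "Suc s"] False exponent_bound_nonneg[of s]
    by (intro mult_right_mono) auto
  also have "\<dots> \<le> exp ((3 + 2 ^ Suc s * (exponent_bound s + 2)) * cmod w ^ Suc s)"
    unfolding exp_le_cancel_iff by (simp add: algebra_simps)
  finally show ?thesis .
qed

text \<open>The only possible loss beyond \<open>exp (- B \<bar>w\<bar>\<^sup>s\<^sup>+\<^sup>1)\<close> is the zero at 1. Its effect is kept as the separate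
factor \<open>t\<close>, to be estimated by the crowding hypothesis; the constant \<open>\<kappa>\<close> relating \<open>t\<close> to \<open>\<bar>1 - w\<bar>\<close> moves
into the exponent, since it matters only when \<open>\<bar>w\<bar> \<ge> 1/2\<close>.\<close>
lemma cmod_weierstrass_factor_ge:
  assumes w: "cmod w \<le> 2" and s: "2 \<le> s" and \<kappa>: "0 < \<kappa>" "\<kappa> \<le> 1"
    and t: "0 \<le> t" "t \<le> 1" "\<kappa> * t \<le> cmod (1 - w)"
  shows "t * exp (- ((6 + 2 ^ Suc s * (exponent_bound s - ln \<kappa>)) * cmod w ^ Suc s))
    \<le> cmod (weierstrass_factor s w)"
proof -
  have ln\<kappa>: "ln \<kappa> \<le> 0" using \<kappa> by simp
  have c: "0 \<le> exponent_bound s - ln \<kappa>" using ln\<kappa> exponent_bound_nonneg[of s] by linarith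
  show ?thesis
  proof (cases "cmod w \<le> 1 / 2")
    case True
    define x where "x = 3 * cmod w ^ Suc s"
    have "cmod w ^ Suc s \<le> (1 / 2) ^ Suc s" using True by (intro power_mono) auto
    also have "(1 / 2 :: real) ^ Suc s \<le> (1 / 2) ^ 3" using s by (intro power_decreasing) auto
    finally have x: "0 \<le> x" "x \<le> 1 / 2" by (auto simp: x_def power3_eq_cube)
    have "- (2 * x) \<le> - x - 2 * x\<^sup>2"
      using mult_left_mono[OF x(2) x(1)] by (simp add: power2_eq_square)
    also have "\<dots> \<le> ln (1 - x)" by (rule ln_one_minus_pos_lower_bound[OF x])
    finally have "exp (- (2 * x)) \<le> 1 - x" using x by (simp add: ln_ge_iff)
    also have "\<dots> \<le> 1 - cmod (weierstrass_factor s w - 1)"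
      using weierstrass_factor_bound[OF True, of s] by (simp add: x_def)
    also have "\<dots> \<le> cmod (weierstrass_factor s w)"
      using norm_triangle_ineq2[of 1 "1 - weierstrass_factor s w"] by (simp add: norm_minus_commute)
    finally have *: "exp (- (2 * x)) \<le> cmod (weierstrass_factor s w)" .
    have "t * exp (- ((6 + 2 ^ Suc s * (exponent_bound s - ln \<kappa>)) * cmod w ^ Suc s))
        \<le> 1 * exp (- (2 * x))"
    proof (rule mult_mono)
      have "2 * x = 6 * cmod w ^ Suc s" by (simp add: x_def)
      also have "\<dots> \<le> (6 + 2 ^ Suc s * (exponent_bound s - ln \<kappa>)) * cmod w ^ Suc s"
        using c by (intro mult_right_mono) auto
      finally show "exp (- ((6 + 2 ^ Suc s * (exponent_bound s - ln \<kappa>)) * cmod w ^ Suc s)) \<le> exp (- (2 * x))"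
        by simp
    qed (use t in auto)
    thus ?thesis using * by linarith
  next
    case False
    have "t * exp (- ((6 + 2 ^ Suc s * (exponent_bound s - ln \<kappa>)) * cmod w ^ Suc s))
       \<le> t * exp (- (exponent_bound s - ln \<kappa>))"
    proof (intro mult_left_mono t)
      have "1 * (exponent_bound s - ln \<kappa>) \<le> (2 ^ Suc s * cmod w ^ Suc s) * (exponent_bound s - ln \<kappa>)"
        using one_le_scaled_power[of "cmod w" "Suc s"] False c by (intro mult_right_mono) auto
      also have "\<dots> \<le> 6 * cmod w ^ Suc s + (2 ^ Suc s * cmod w ^ Suc s) * (exponent_bound s - ln \<kappa>)"
        by simp
      also have "\<dots> = (6 + 2 ^ Suc s * (exponent_bound s - ln \<kappa>)) * cmod w ^ Suc s"
        by (simp add: algebra_simps)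
      finally show "exp (- ((6 + 2 ^ Suc s * (exponent_bound s - ln \<kappa>)) * cmod w ^ Suc s))
          \<le> exp (- (exponent_bound s - ln \<kappa>))" by simp
    qed
    also have "\<dots> = \<kappa> * t * exp (- exponent_bound s)"
      using \<kappa> by (simp add: exp_diff exp_minus field_simps)
    also have "\<dots> \<le> cmod (1 - w) * exp (Re (\<Sum>k=1..s. w ^ k / of_nat k))"
    proof (rule mult_mono)
      show "exp (- exponent_bound s) \<le> exp (Re (\<Sum>k=1..s. w ^ k / of_nat k))"
        unfolding exp_le_cancel_iff
        using abs_Re_le_cmod[of "\<Sum>k=1..s. w ^ k / of_nat k"] cmod_weierstrass_exponent_le[OF w, of s]
        by linarith
    qed (use t in auto)
    also have "\<dots> = cmod (weierstrass_factor s w)"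
      by (simp only: weierstrass_factor_def norm_mult norm_exp_eq_Re)
    finally show ?thesis .
  qed
qed

section \<open>Canonical products with one node omitted\<close>

context sparse_points
begin

definition node_growth :: "nat \<Rightarrow> real" where
  "node_growth n = growth (1 / (1 - cmod (z n)))"

lemma inverse_gap_ge_1: "cmod u < 1 \<Longrightarrow> 1 \<le> 1 / (1 - cmod u)"
  by (simp add: le_divide_eq)

lemma node_growth_ge_1: "n \<in> I \<Longrightarrow> 1 \<le> node_growth n"
  unfolding node_growth_def by (intro growth_ge_1 inverse_gap_ge_1 in_disc)

text \<open>With \<open>d = (1 - \<bar>z\<^sub>m\<bar>) / 2\<close>, the exponential is \<open>min 1 (\<bar>z\<^sub>k - z\<^sub>m\<bar> / d)\<close>. Nodes farther than \<open>d\<close> from \<open>z\<^sub>m\<close>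
are uniformly separated from it in the pseudohyperbolic metric, and for closer ones this metric is
comparable to the Euclidean one divided by \<open>d\<close>.\<close>
lemma one_minus_kernel_at_node_ge:
  assumes k: "k \<in> I" and m: "m \<in> I" and ne: "k \<noteq> m"
  shows "\<eta> / 5 * exp (- max 0 (ln ((1 - cmod (z m)) / 2 / cmod (z k - z m))))
    \<le> cmod (1 - disc_kernel (z k) (z m))"
proof -
  define d where "d = (1 - cmod (z m)) / 2"
  define X where "X = cmod (z k - z m)"
  define R where "R = cmod (1 - cnj (z k) * z m)"
  have d: "0 < d" using in_disc[OF m] by (simp add: d_def)
  have X: "0 < X" using inj_z k m ne by (auto simp: X_def dest: inj_onD)
  have "R = cmod (of_real (1 - (cmod (z m))\<^sup>2) + cnj (z m - z k) * z m)"
    unfolding R_def of_real_diff of_real_power of_real_cmod_square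
    by (simp add: algebra_simps)
  also have "\<dots> \<le> (1 - (cmod (z m))\<^sup>2) + X * cmod (z m)"
  proof -
    have "0 \<le> 1 - (cmod (z m))\<^sup>2" using in_disc[OF m] by (simp add: power_le_one)
    hence "cmod (of_real (1 - (cmod (z m))\<^sup>2)) = 1 - (cmod (z m))\<^sup>2"
      by (simp only: norm_of_real abs_of_nonneg)
    moreover have "cmod (cnj (z m - z k) * z m) = X * cmod (z m)"
      unfolding X_def norm_mult complex_mod_cnj by (simp add: norm_minus_commute)
    ultimately show ?thesis using norm_triangle_ineq by metis
  qed
  also have "\<dots> \<le> 4 * d + X"
  proof -
    have "1 - (cmod (z m))\<^sup>2 = (1 - cmod (z m)) * (1 + cmod (z m))"
      by (simp add: power2_eq_square algebra_simps)
    also have "\<dots> \<le> (1 - cmod (z m)) * 2" using in_disc[OF m] by (intro mult_left_mono) auto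
    finally have "1 - (cmod (z m))\<^sup>2 \<le> 4 * d" by (simp add: d_def)
    moreover have "X * cmod (z m) \<le> X" using X in_disc[OF m] by (simp add: mult_left_le)
    ultimately show ?thesis by linarith
  qed
  finally have R: "R \<le> 4 * d + X" .
  have R0: "0 < R" using one_minus_cnj_mult_nonzero[OF in_disc[OF k] in_disc[OF m]] by (simp add: R_def)
  have t: "exp (- max 0 (ln (d / X))) = min 1 (X / d)"
  proof (cases "X \<le> d")
    case True
    hence "0 \<le> ln (d / X)" using X by simp
    thus ?thesis using True X d by (simp add: exp_minus max_def min_def)
  next
    case False
    hence "ln (d / X) \<le> 0" using X d by (simp add: ln_le_zero_iff)
    thus ?thesis using False d by (simp add: max_def min_def)
  qed
  have "min 1 (X / d) * R \<le> min 1 (X / d) * (4 * d + X)"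
    using R X d by (intro mult_left_mono) auto
  also have "\<dots> \<le> 5 * X"
  proof (cases "X \<le> d")
    case True
    have "X / d * X \<le> X" using True X d by (simp add: field_simps)
    thus ?thesis using True X d by (simp add: min_def algebra_simps)
  next
    case False
    thus ?thesis using d by (simp add: min_def)
  qed
  finally have "\<eta> / 5 * min 1 (X / d) * R \<le> \<eta> * X"
    using eta_pos mult_left_mono[of _ _ "\<eta> / 5"] by fastforce
  hence "\<eta> / 5 * min 1 (X / d) \<le> \<eta> * X / R" using R0 by (simp add: le_divide_eq)
  also have "\<dots> \<le> cmod (z k) * X / R"
    using eta_le[OF k] X R0 by (intro divide_right_mono mult_right_mono) auto
  also have "\<dots> = cmod (1 - disc_kernel (z k) (z m))"
    unfolding one_minus_disc_kernel[OF in_disc[OF k] in_disc[OF m]]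
    by (simp add: norm_divide norm_mult X_def R_def)
  finally show ?thesis unfolding t[symmetric] unfolding d_def X_def .
qed

text \<open>Omitting the factor of the node \<open>n\<close> takes the place of dividing the full product by \<open>u - z\<^sub>n\<close>, as Lagrange's
formula would have it.\<close>
definition omitted_product :: "nat set \<Rightarrow> nat \<Rightarrow> complex \<Rightarrow> complex" where
  "omitted_product F n u = (\<Prod>k\<in>F - {n}. weierstrass_factor (q + 3) (disc_kernel (z k) u))"

lemma omitted_product_holomorphic:
  "F \<subseteq> I \<Longrightarrow> omitted_product F n holomorphic_on ball 0 1"
  unfolding omitted_product_def
  by (intro holomorphic_intros disc_kernel_holomorphic) (auto intro: in_disc)

lemma omitted_product_at_other_node:
  assumes "finite F" "F \<subseteq> I" "m \<in> F" "m \<noteq> n"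
  shows "omitted_product F n (z m) = 0"
  unfolding omitted_product_def
  using assms disc_kernel_self[of "z m"] in_disc[of m]
  by (intro prod_zero) (auto intro!: bexI[of _ m])

lemma omitted_product_le:
  obtains C where "0 < C"
    "\<And>F n u. finite F \<Longrightarrow> F \<subseteq> I \<Longrightarrow> cmod u < 1 \<Longrightarrow>
      cmod (omitted_product F n u) \<le> exp (C * growth (1 / (1 - cmod u)))"
proof -
  obtain S where S: "0 < S" "\<And>u F. cmod u < 1 \<Longrightarrow> finite F \<Longrightarrow> F \<subseteq> I \<Longrightarrow>
      (\<Sum>n\<in>F. cmod (disc_kernel (z n) u) ^ (q + 4)) \<le> S * growth (1 / (1 - cmod u))"
    using kernel_sum_bound by blast
  define A where "A = 3 + 2 ^ (q + 4) * (exponent_bound (q + 3) + 2)"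
  have A: "0 < A" using exponent_bound_nonneg[of "q + 3"] by (simp add: A_def add_pos_nonneg)
  show ?thesis
  proof (rule that)
    show "0 < A * S" using A S by simp
    fix F n u assume F: "finite F" "F \<subseteq> I" and u: "cmod u < 1"
    have "cmod (omitted_product F n u) =
        (\<Prod>k\<in>F - {n}. cmod (weierstrass_factor (q + 3) (disc_kernel (z k) u)))"
      by (simp add: omitted_product_def prod_norm)
    also have "\<dots> \<le> (\<Prod>k\<in>F - {n}. exp (A * cmod (disc_kernel (z k) u) ^ (q + 4)))"
    proof (intro prod_mono conjI norm_ge_zero)
      fix k assume "k \<in> F - {n}"
      hence "cmod (disc_kernel (z k) u) \<le> 2"
        using F u by (intro cmod_disc_kernel_le_2 in_disc) auto
      from cmod_weierstrass_factor_le[OF this, of "q + 3"]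
      show "cmod (weierstrass_factor (q + 3) (disc_kernel (z k) u))
          \<le> exp (A * cmod (disc_kernel (z k) u) ^ (q + 4))"
        by (simp add: A_def eval_nat_numeral)
    qed
    also have "\<dots> = exp (A * (\<Sum>k\<in>F - {n}. cmod (disc_kernel (z k) u) ^ (q + 4)))"
      using F by (simp add: exp_sum sum_distrib_left)
    also have "\<dots> \<le> exp (A * S * growth (1 / (1 - cmod u)))"
      using S(2)[OF u, of "F - {n}"] F A by auto
    finally show "cmod (omitted_product F n u) \<le> exp (A * S * growth (1 / (1 - cmod u)))" .
  qed
qed

text \<open>This is where the hypothesis is used at full strength: the losses caused by the zeros near \<open>z\<^sub>n\<close> multiply
to the exponential of minus the crowding sum, hence to at least \<open>exp (- C\<^sub>1 \<psi>(1 / (1 - \<bar>z\<^sub>n\<bar>)))\<close>.\<close>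
lemma omitted_product_at_own_node_ge:
  obtains C where "0 < C"
    "\<And>F n. finite F \<Longrightarrow> F \<subseteq> I \<Longrightarrow> n \<in> I \<Longrightarrow>
      exp (- (C * node_growth n)) \<le> cmod (omitted_product F n (z n))"
proof -
  obtain S where S: "0 < S" "\<And>u F. cmod u < 1 \<Longrightarrow> finite F \<Longrightarrow> F \<subseteq> I \<Longrightarrow>
      (\<Sum>n\<in>F. cmod (disc_kernel (z n) u) ^ (q + 4)) \<le> S * growth (1 / (1 - cmod u))"
    using kernel_sum_bound by blast
  define \<kappa> where "\<kappa> = min 1 (\<eta> / 5)"
  have \<kappa>: "0 < \<kappa>" "\<kappa> \<le> 1" "\<kappa> \<le> \<eta> / 5" using eta_pos by (auto simp: \<kappa>_def)
  define B where "B = 6 + 2 ^ (q + 4) * (exponent_bound (q + 3) - ln \<kappa>)"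
  have B: "0 < B"
  proof -
    have "0 \<le> exponent_bound (q + 3) - ln \<kappa>"
    proof -
      have "ln \<kappa> \<le> 0" using \<kappa> by simp
      thus ?thesis using exponent_bound_nonneg[of "q + 3"] by linarith
    qed
    thus ?thesis by (simp add: B_def add_pos_nonneg)
  qed
  show ?thesis
  proof (rule that)
    show "0 < C\<^sub>1 * psi_const + B * S" using C1_pos psi_const_pos B S by (simp add: add_pos_pos)
    fix F n assume F: "finite F" "F \<subseteq> I" and n: "n \<in> I"
    define l where "l k = max 0 (ln ((1 - cmod (z n)) / 2 / cmod (z k - z n)))" for k
    define p where "p k = cmod (disc_kernel (z k) (z n)) ^ (q + 4)" for k
    have "(\<Sum>k\<in>F - {n}. l k) \<le> C\<^sub>1 * \<psi> (1 / (1 - cmod (z n)))"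
      unfolding l_def using F by (intro crowding n) auto
    also have "\<dots> \<le> C\<^sub>1 * (psi_const * node_growth n)"
      unfolding node_growth_def
      by (intro mult_left_mono psi_le_growth inverse_gap_ge_1 in_disc n less_imp_le[OF C1_pos])
    finally have l: "(\<Sum>k\<in>F - {n}. l k) \<le> C\<^sub>1 * psi_const * node_growth n" by simp
    have "B * (\<Sum>k\<in>F - {n}. p k) \<le> B * (S * node_growth n)"
      unfolding p_def node_growth_def using B F in_disc[OF n] by (intro mult_left_mono S(2)) auto
    hence "exp (- ((C\<^sub>1 * psi_const + B * S) * node_growth n))
        \<le> exp (- (\<Sum>k\<in>F - {n}. l k) - B * (\<Sum>k\<in>F - {n}. p k))"
      unfolding exp_le_cancel_iff using l by (simp add: algebra_simps)
    also have "\<dots> = exp (\<Sum>k\<in>F - {n}. - l k - B * p k)"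
      by (simp add: sum_subtractf sum_negf sum_distrib_left)
    also have "\<dots> = (\<Prod>k\<in>F - {n}. exp (- l k) * exp (- (B * p k)))"
      using F by (simp add: exp_sum flip: exp_add)
    also have "\<dots> \<le> (\<Prod>k\<in>F - {n}. cmod (weierstrass_factor (q + 3) (disc_kernel (z k) (z n))))"
    proof (intro prod_mono conjI)
      fix k assume k: "k \<in> F - {n}"
      hence kI: "k \<in> I" "k \<noteq> n" using F by auto
      have "\<kappa> * exp (- l k) \<le> \<eta> / 5 * exp (- l k)" using \<kappa> by (intro mult_right_mono) auto
      also have "\<dots> \<le> cmod (1 - disc_kernel (z k) (z n))"
        unfolding l_def by (rule one_minus_kernel_at_node_ge[OF kI(1) n kI(2)])
      finally have "\<kappa> * exp (- l k) \<le> cmod (1 - disc_kernel (z k) (z n))" .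
      from cmod_weierstrass_factor_ge[OF cmod_disc_kernel_le_2[OF in_disc[OF kI(1)] in_disc[OF n]] _ \<kappa>(1,2) _ _ this, of "q + 3"]
      show "exp (- l k) * exp (- (B * p k)) \<le> cmod (weierstrass_factor (q + 3) (disc_kernel (z k) (z n)))"
        by (simp add: B_def p_def l_def eval_nat_numeral)
    qed auto
    also have "\<dots> = cmod (omitted_product F n (z n))"
      by (simp add: omitted_product_def prod_norm)
    finally show "exp (- ((C\<^sub>1 * psi_const + B * S) * node_growth n)) \<le> cmod (omitted_product F n (z n))" .
  qed
qed

text \<open>A high power of the kernel of \<open>z\<^sub>n\<close>, equal to 1 at \<open>z\<^sub>n\<close>, neutralises the large coefficient \<open>exp (K G)\<close>,
\<open>G\<close> being the growth at \<open>z\<^sub>n\<close>. Where the kernel is at most 1/2 the power alone suffices. Elsewhere \<open>u\<close> is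
at most four times farther from the circle than \<open>z\<^sub>n\<close>, so that \<open>G\<close> is dominated by the growth at \<open>u\<close>.\<close>
lemma peak_power_bound:
  assumes "0 < K"
  obtains C where "0 < C"
    "\<And>n u. n \<in> I \<Longrightarrow> cmod u < 1 \<Longrightarrow>
      exp (K * node_growth n) * cmod (disc_kernel (z n) u) ^ nat \<lceil>2 * K * node_growth n\<rceil>
        \<le> exp (C * growth (1 / (1 - cmod u)))"
proof -
  obtain C4 where C4: "1 \<le> C4" "\<And>x. 1 \<le> x \<Longrightarrow> growth (4 * x) \<le> C4 * growth x"
    using growth_quadruple by blast
  show ?thesis
  proof (rule that)
    show "0 < 3 * K * C4 + 1" using assms C4 by (simp add: add_pos_pos)
    fix n u assume n: "n \<in> I" and u: "cmod u < 1"
    define G where "G = node_growth n"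
    define H where "H = growth (1 / (1 - cmod u))"
    define N where "N = nat \<lceil>2 * K * G\<rceil>"
    define w where "w = cmod (disc_kernel (z n) u)"
    have G: "1 \<le> G" using node_growth_ge_1[OF n] by (simp add: G_def)
    have H: "1 \<le> H" unfolding H_def by (intro growth_ge_1 inverse_gap_ge_1 u)
    have KG: "0 < K * G" using G assms by simp
    have N: "2 * K * G \<le> real N" "real N \<le> 2 * K * G + 1"
    proof -
      have "real N = real_of_int \<lceil>2 * K * G\<rceil>" using KG by (simp add: N_def)
      thus "2 * K * G \<le> real N" "real N \<le> 2 * K * G + 1" by linarith+
    qed
    have w0: "0 \<le> w" by (simp add: w_def)
    have "exp (K * G) * w ^ N \<le> exp ((3 * K * C4 + 1) * H)"
    proof (cases "w \<le> 1 / 2")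
      case True
      have "w ^ N \<le> (1 / 2) ^ N" using True w0 by (intro power_mono) auto
      also have "\<dots> = exp (- (real N * ln 2))"
        by (simp add: exp_minus exp_of_nat_mult power_one_over inverse_eq_divide)
      also have "\<dots> \<le> exp (- (K * G))"
      proof -
        have "(2 * K * G) * (1 / 2) \<le> real N * ln 2"
          using N(1) KG ln2_ge_two_thirds by (intro mult_mono) auto
        thus ?thesis by simp
      qed
      finally have "exp (K * G) * w ^ N \<le> exp (K * G) * exp (- (K * G))"
        by (intro mult_left_mono) auto
      also have "\<dots> = exp 0" by (simp flip: exp_add)
      also have "\<dots> \<le> exp ((3 * K * C4 + 1) * H)"
        unfolding exp_le_cancel_iff using assms C4 H by (intro mult_nonneg_nonneg) auto
      finally show ?thesis .
    next
      case False
      define R where "R = cmod (1 - cnj (z n) * u)"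
      have R: "1 - cmod u \<le> R" using cmod_one_minus_cnj_mult_ge(1)[OF in_disc[OF n] u] by (simp add: R_def)
      have "w \<le> 2 * (1 - cmod (z n)) / R"
        unfolding w_def R_def by (rule cmod_disc_kernel_le[OF in_disc[OF n] u])
      hence "1 / 2 < 2 * (1 - cmod (z n)) / R" using False by linarith
      hence "R < 4 * (1 - cmod (z n))" using R u by (simp add: less_divide_eq split: if_splits)
      hence "1 - cmod u \<le> 4 * (1 - cmod (z n))" using R by linarith
      hence "1 / (1 - cmod (z n)) \<le> 4 * (1 / (1 - cmod u))"
        using u in_disc[OF n] by (simp add: field_simps)
      hence "G \<le> growth (4 * (1 / (1 - cmod u)))"
        unfolding G_def node_growth_def by (intro growth_mono inverse_gap_ge_1 in_disc n)
      also have "\<dots> \<le> C4 * H" unfolding H_def by (intro C4 inverse_gap_ge_1 u)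
      finally have GH: "G \<le> C4 * H" .
      have "w ^ N \<le> 2 ^ N"
        using cmod_disc_kernel_le_2[OF in_disc[OF n] u] w0 by (intro power_mono) (auto simp: w_def)
      also have "\<dots> \<le> exp 1 ^ N"
        using exp_ge_add_one_self[of 1] by (intro power_mono) auto
      also have "\<dots> = exp (real N)" by (simp flip: exp_of_nat_mult)
      also have "\<dots> \<le> exp (2 * K * G + 1)" using N by simp
      finally have "exp (K * G) * w ^ N \<le> exp (K * G) * exp (2 * K * G + 1)"
        by (intro mult_left_mono) auto
      also have "\<dots> = exp (3 * K * G + 1)" by (simp flip: exp_add)
      also have "\<dots> \<le> exp ((3 * K * C4 + 1) * H)"
      proof -
        have "3 * K * G \<le> 3 * K * (C4 * H)" using GH assms by (intro mult_left_mono) auto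
        moreover have "(3 * K * C4 + 1) * H = 3 * K * (C4 * H) + H" by (simp add: distrib_right)
        ultimately show ?thesis unfolding exp_le_cancel_iff using H by linarith
      qed
      finally show ?thesis .
    qed
    thus "exp (K * node_growth n) * cmod (disc_kernel (z n) u) ^ nat \<lceil>2 * K * node_growth n\<rceil>
        \<le> exp ((3 * K * C4 + 1) * growth (1 / (1 - cmod u)))"
      by (simp only: G_def H_def N_def w_def)
  qed
qed

end

section \<open>Interpolation with growth control\<close>

context sparse_points
begin

text \<open>The constant does not depend on the finite set \<open>F\<close>; this uniformity is what the passage to infinitely
many nodes requires. The interpolating function is a Lagrange sum of omitted products, each multiplied by
a power of the kernel of its node.\<close>
lemma finite_interpolation:
  assumes K': "0 < K'"
  obtains C where "0 < C"
    "\<And>F a. finite F \<Longrightarrow> F \<subseteq> I \<Longrightarrow> (\<And>n. n \<in> F \<Longrightarrow> cmod (a n) \<le> exp (K' * node_growth n)) \<Longrightarrow>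
      \<exists>f. f holomorphic_on ball 0 1 \<and> (\<forall>n\<in>F. f (z n) = a n) \<and>
        (\<forall>u\<in>ball 0 1. cmod (f u) \<le> exp (C * growth (1 / (1 - cmod u))))"
proof -
  obtain S where S: "0 < S" "\<And>u F. cmod u < 1 \<Longrightarrow> finite F \<Longrightarrow> F \<subseteq> I \<Longrightarrow>
      (\<Sum>n\<in>F. cmod (disc_kernel (z n) u) ^ (q + 4)) \<le> S * growth (1 / (1 - cmod u))"
    using kernel_sum_bound by blast
  obtain U where U: "0 < U" "\<And>F n u. finite F \<Longrightarrow> F \<subseteq> I \<Longrightarrow> cmod u < 1 \<Longrightarrow>
      cmod (omitted_product F n u) \<le> exp (U * growth (1 / (1 - cmod u)))"
    using omitted_product_le by blast
  obtain L where L: "0 < L" "\<And>F n. finite F \<Longrightarrow> F \<subseteq> I \<Longrightarrow> n \<in> I \<Longrightarrow>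
      exp (- (L * node_growth n)) \<le> cmod (omitted_product F n (z n))"
    using omitted_product_at_own_node_ge by blast
  define K where "K = K' + L"
  have K: "0 < K" using K' L by (simp add: K_def)
  obtain P where P: "0 < P" "\<And>n u. n \<in> I \<Longrightarrow> cmod u < 1 \<Longrightarrow>
      exp (K * node_growth n) * cmod (disc_kernel (z n) u) ^ nat \<lceil>2 * K * node_growth n\<rceil>
        \<le> exp (P * growth (1 / (1 - cmod u)))"
    using peak_power_bound[OF K] by blast
  define N where "N n = nat \<lceil>2 * K * node_growth n\<rceil>" for n
  show ?thesis
  proof (rule that)
    show "0 < U + P + S" using U P S by simp
    fix F a assume F: "finite F" "F \<subseteq> I" and a: "\<And>n. n \<in> F \<Longrightarrow> cmod (a n) \<le> exp (K' * node_growth n)"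
    define c where "c n = a n / omitted_product F n (z n)" for n
    \<comment> \<open>The exponent \<open>N n\<close> compensates for \<open>c n\<close>, and the other \<open>q + 4\<close> powers bound the sum independently of \<open>F\<close>.\<close>
    define f where "f u = (\<Sum>n\<in>F. c n * (omitted_product F n u * disc_kernel (z n) u ^ (q + 4 + N n)))" for u
    have Q0: "omitted_product F n (z n) \<noteq> 0" if "n \<in> F" for n
    proof -
      have "0 < cmod (omitted_product F n (z n))"
        using less_le_trans[OF exp_gt_zero L(2)[OF F, of n]] that F by blast
      thus ?thesis by simp
    qed
    have c: "cmod (c n) \<le> exp (K * node_growth n)" if "n \<in> F" for n
    proof -
      have nI: "n \<in> I" using that F by blast
      have "cmod (c n) = cmod (a n) / cmod (omitted_product F n (z n))"
        by (simp add: c_def norm_divide)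
      also have "\<dots> \<le> exp (K' * node_growth n) / exp (- (L * node_growth n))"
        by (intro frac_le a that L(2)[OF F nI]) auto
      also have "\<dots> = exp (K * node_growth n)"
        by (simp add: K_def distrib_right flip: exp_diff)
      finally show ?thesis .
    qed
    have "f holomorphic_on ball 0 1"
      unfolding f_def
      by (intro holomorphic_intros omitted_product_holomorphic disc_kernel_holomorphic)
        (use F in \<open>auto intro: in_disc\<close>)
    moreover have "f (z m) = a m" if m: "m \<in> F" for m
    proof -
      have "f (z m) = (\<Sum>n\<in>F. if n = m then a m else 0)"
        unfolding f_def
      proof (rule sum.cong)
        fix n assume n: "n \<in> F"
        show "c n * (omitted_product F n (z m) * disc_kernel (z n) (z m) ^ (q + 4 + N n)) = (if n = m then a m else 0)"
          using omitted_product_at_other_node[OF F m, of n] disc_kernel_self[OF in_disc, of m] Q0[OF m] m F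
          by (auto simp: c_def)
      qed simp
      thus ?thesis using F m by simp
    qed
    moreover have "cmod (f u) \<le> exp ((U + P + S) * growth (1 / (1 - cmod u)))" if "u \<in> ball 0 1" for u
    proof -
      have u: "cmod u < 1" using that by simp
      define H where "H = growth (1 / (1 - cmod u))"
      have "cmod (f u) \<le> (\<Sum>n\<in>F. exp (U * H) * exp (P * H) * cmod (disc_kernel (z n) u) ^ (q + 4))"
        unfolding f_def
      proof (rule sum_norm_le)
        fix n assume n: "n \<in> F"
        hence nI: "n \<in> I" using F by blast
        define w where "w = cmod (disc_kernel (z n) u)"
        have "cmod (c n * (omitted_product F n u * disc_kernel (z n) u ^ (q + 4 + N n)))
            = cmod (c n) * (cmod (omitted_product F n u) * (w ^ (q + 4) * w ^ N n))"
          by (simp add: norm_mult norm_power power_add w_def)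
        also have "\<dots> \<le> exp (K * node_growth n) * (exp (U * H) * (w ^ (q + 4) * w ^ N n))"
          using c[OF n] U(2)[OF F u, of n]
          by (intro mult_mono) (auto simp: w_def H_def)
        also have "\<dots> = exp (U * H) * (exp (K * node_growth n) * w ^ N n) * w ^ (q + 4)"
          by (simp only: mult_ac)
        also have "\<dots> \<le> exp (U * H) * exp (P * H) * w ^ (q + 4)"
          using P(2)[OF nI u] by (intro mult_right_mono mult_left_mono) (auto simp: w_def N_def H_def)
        finally show "cmod (c n * (omitted_product F n u * disc_kernel (z n) u ^ (q + 4 + N n)))
            \<le> exp (U * H) * exp (P * H) * cmod (disc_kernel (z n) u) ^ (q + 4)"
          by (simp only: w_def)
      qed
      also have "\<dots> = exp (U * H) * exp (P * H) * (\<Sum>n\<in>F. cmod (disc_kernel (z n) u) ^ (q + 4))"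
        by (simp add: sum_distrib_left)
      also have "\<dots> \<le> exp (U * H) * exp (P * H) * exp (S * H)"
      proof (rule mult_left_mono)
        have "(\<Sum>n\<in>F. cmod (disc_kernel (z n) u) ^ (q + 4)) \<le> S * H"
          unfolding H_def by (rule S(2)[OF u F])
        also have "\<dots> \<le> exp (S * H)" using exp_ge_add_one_self[of "S * H"] by linarith
        finally show "(\<Sum>n\<in>F. cmod (disc_kernel (z n) u) ^ (q + 4)) \<le> exp (S * H)" .
      qed simp
      also have "\<dots> = exp ((U + P + S) * H)" by (simp add: distrib_right exp_add)
      finally show ?thesis by (simp only: H_def)
    qed
    ultimately show "\<exists>f. f holomorphic_on ball 0 1 \<and> (\<forall>n\<in>F. f (z n) = a n) \<and>
        (\<forall>u\<in>ball 0 1. cmod (f u) \<le> exp ((U + P + S) * growth (1 / (1 - cmod u))))"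
      by blast
  qed
qed

text \<open>The interpolants of the finite subproblems are uniformly bounded on compact subsets of the disc, so by
Montel's theorem a subsequence converges. The limit inherits the bound, and its value at each node is
that of all but finitely many of the interpolants. This spares any discussion of the convergence of
infinite products or series.\<close>
lemma interpolation:
  assumes K: "0 < K" and a: "\<And>n. n \<in> I \<Longrightarrow> cmod (a n) \<le> exp (K * node_growth n)"
  shows "\<exists>C>0. \<exists>g. g holomorphic_on ball 0 1 \<and> (\<forall>n\<in>I. g (z n) = a n) \<and>
    (\<forall>u\<in>ball 0 1. cmod (g u) \<le> exp (C * growth (1 / (1 - cmod u))))"
proof -
  obtain C where C: "0 < C"
    "\<And>F a. finite F \<Longrightarrow> F \<subseteq> I \<Longrightarrow> (\<And>n. n \<in> F \<Longrightarrow> cmod (a n) \<le> exp (K * node_growth n)) \<Longrightarrow>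
      \<exists>f. f holomorphic_on ball 0 1 \<and> (\<forall>n\<in>F. f (z n) = a n) \<and>
        (\<forall>u\<in>ball 0 1. cmod (f u) \<le> exp (C * growth (1 / (1 - cmod u))))"
    using finite_interpolation[OF K] by blast
  have "\<exists>f. f holomorphic_on ball 0 1 \<and> (\<forall>n\<in>I \<inter> {..<N}. f (z n) = a n) \<and>
      (\<forall>u\<in>ball 0 1. cmod (f u) \<le> exp (C * growth (1 / (1 - cmod u))))" for N
    by (rule C(2)) (use a in auto)
  then obtain f where f: "\<And>N. f N holomorphic_on ball 0 1"
      "\<And>N n. n \<in> I \<Longrightarrow> n < N \<Longrightarrow> f N (z n) = a n"
      "\<And>N u. u \<in> ball 0 1 \<Longrightarrow> cmod (f N u) \<le> exp (C * growth (1 / (1 - cmod u)))"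
    by (metis IntI lessThan_iff)
  obtain g r where g: "g holomorphic_on ball 0 1" "strict_mono (r :: nat \<Rightarrow> nat)"
    "\<And>u. u \<in> ball 0 1 \<Longrightarrow> (\<lambda>N. f (r N) u) \<longlonglongrightarrow> g u"
  proof (rule Montel[of "ball 0 1" "range f" f])
    fix X :: "complex set" assume X: "compact X" "X \<subseteq> ball 0 1"
    show "\<exists>B. \<forall>h\<in>range f. \<forall>u\<in>X. cmod (h u) \<le> B"
    proof (cases "X = {}")
      case False
      then obtain v where v: "v \<in> X" "\<And>u. u \<in> X \<Longrightarrow> cmod u \<le> cmod v"
        using continuous_attains_sup[OF X(1), of cmod] by (auto intro: continuous_intros)
      have "cmod v < 1" using v X by auto
      have "cmod (f N u) \<le> exp (C * growth (1 / (1 - cmod v)))" if "u \<in> X" for N u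
      proof -
        have u: "cmod u < 1" using that X by auto
        have "growth (1 / (1 - cmod u)) \<le> growth (1 / (1 - cmod v))"
          using v(2)[OF that] \<open>cmod v < 1\<close> by (intro growth_mono inverse_gap_ge_1 u frac_le) auto
        hence le: "exp (C * growth (1 / (1 - cmod u))) \<le> exp (C * growth (1 / (1 - cmod v)))"
          using C(1) by simp
        show ?thesis by (rule order_trans[OF f(3) le]) (use u in simp)
      qed
      thus ?thesis by blast
    qed auto
  qed (use f(1) in auto)
  have "g (z n) = a n" if n: "n \<in> I" for n
  proof -
    have "eventually (\<lambda>N. f (r N) (z n) = a n) sequentially"
      using eventually_gt_at_top[of n]
    proof eventually_elim
      case (elim N)
      thus ?case using seq_suble[OF g(2), of N] f(2)[OF n, of "r N"] by simp
    qed
    moreover have "(\<lambda>N. f (r N) (z n)) \<longlonglongrightarrow> g (z n)"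
      using g(3)[of "z n"] in_disc[OF n] by simp
    ultimately have "(\<lambda>_. a n) \<longlonglongrightarrow> g (z n)"
      by (rule Lim_transform_eventually[rotated])
    thus ?thesis by (simp add: LIMSEQ_const_iff)
  qed
  moreover have "cmod (g u) \<le> exp (C * growth (1 / (1 - cmod u)))" if u: "u \<in> ball 0 1" for u
    by (rule Lim_norm_ubound[OF _ g(3)[OF u]]) (use f(3)[OF u] in auto)
  ultimately show ?thesis using C(1) g(1) by blast
qed

end

section \<open>Extracting the quantitative hypotheses\<close>

lemma doubling_weight_of_bigo:
  fixes \<psi> :: "real \<Rightarrow> real"
  assumes pos: "\<forall>x\<ge>1. \<psi> x > 0" and mono: "mono_on {1..} \<psi>"
    and dbl: "(\<lambda>x. \<psi> (2 * x)) \<in> O[at_top](\<psi>)"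
  obtains D q where "doubling_weight \<psi> D q"
proof -
  obtain c where c: "eventually (\<lambda>x. norm (\<psi> (2 * x)) \<le> c * norm (\<psi> x)) at_top"
    using landau_o.bigE[OF dbl] by blast
  then obtain X where X: "\<And>x. X \<le> x \<Longrightarrow> norm (\<psi> (2 * x)) \<le> c * norm (\<psi> x)"
    by (auto simp: eventually_at_top_linorder)
  have mono': "\<psi> x \<le> \<psi> y" if "1 \<le> x" "x \<le> y" for x y
    using mono that by (auto simp: mono_on_def)
  define Y where "Y = max 1 X"
  define D where "D = max c (\<psi> (2 * Y) / \<psi> 1)"
  have D: "\<psi> (2 * x) \<le> D * \<psi> x" if x: "1 \<le> x" for x
  proof (cases "X \<le> x")
    case True
    have "\<psi> (2 * x) \<le> c * \<psi> x" using X[OF True] pos[rule_format, of x] pos[rule_format, of "2 * x"] x by simp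
    also have "\<dots> \<le> D * \<psi> x" using pos x by (intro mult_right_mono) (auto simp: D_def less_imp_le)
    finally show ?thesis .
  next
    case False
    have p1: "0 < \<psi> 1" "0 < \<psi> (2 * Y)" using pos by (auto simp: Y_def)
    have "\<psi> (2 * x) \<le> \<psi> (2 * Y)" using False x by (intro mono') (auto simp: Y_def)
    also have "\<dots> = \<psi> (2 * Y) / \<psi> 1 * \<psi> 1" using p1 by simp
    also have "\<dots> \<le> D * \<psi> x"
    proof (rule mult_mono)
      show "0 \<le> D" using divide_pos_pos[OF p1(2,1)] by (simp add: D_def le_max_iff_disj)
    qed (use p1 mono'[OF _ x] in \<open>auto simp: D_def\<close>)
    finally show ?thesis .
  qed
  obtain q where "2 * D < 2 ^ q" using real_arch_pow[of 2 "2 * D"] by auto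
  hence "doubling_weight \<psi> D q"
    using pos mono' D by unfold_locales auto
  thus ?thesis by (rule that)
qed

lemma nn_integral_inverse_Icc:
  fixes x d :: real
  assumes "0 < x" "x \<le> d"
  shows "(\<integral>\<^sup>+t. ennreal (1 / t) * indicator {x..d} t \<partial>lborel) = ennreal (ln (d / x))"
proof -
  have "(\<integral>\<^sup>+t. ennreal (1 / t) * indicator {x..d} t \<partial>lborel) = ennreal (ln d - ln x)"
    using assms by (intro nn_integral_FTC_Icc) (auto intro!: derivative_eq_intros simp: inverse_eq_divide)
  thus ?thesis using assms by (simp add: ln_div)
qed

text \<open>The positive part of the counting function minus 1 discards the node \<open>z\<^sub>m\<close> itself, so it is at least the
number of indices in \<open>F\<close> that are counted. Integrating indicator functions against \<open>1 / t\<close> gives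
the logarithms.\<close>
lemma disc_N_ge_log_sum:
  assumes inj: "inj z" and F: "finite F" "m \<notin> F" and d: "0 < d"
  shows "ennreal (\<Sum>k\<in>F. max 0 (ln (d / cmod (z k - z m)))) \<le> disc_N z (z m) d"
proof -
  define x where "x k = cmod (z k - z m)" for k
  have x: "0 < x k" if "k \<in> F" for k
    using that F inj by (auto simp: x_def dest: injD)
  have "ennreal (\<Sum>k\<in>F. max 0 (ln (d / x k))) = (\<Sum>k\<in>F. ennreal (max 0 (ln (d / x k))))"
    by (simp add: sum_ennreal)
  also have "\<dots> = (\<Sum>k\<in>F. \<integral>\<^sup>+t. ennreal (1 / t) * indicator {x k..d} t \<partial>lborel)"
  proof (rule sum.cong)
    fix k assume k: "k \<in> F"
    show "ennreal (max 0 (ln (d / x k))) = (\<integral>\<^sup>+t. ennreal (1 / t) * indicator {x k..d} t \<partial>lborel)"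
    proof (cases "x k \<le> d")
      case True
      have "0 \<le> ln (d / x k)" using True x[OF k] by simp
      thus ?thesis using nn_integral_inverse_Icc[OF x[OF k] True] by (simp add: max_def)
    next
      case False
      hence "ln (d / x k) \<le> 0" using x[OF k] d by (simp add: ln_le_zero_iff)
      thus ?thesis using False by (simp add: max_def)
    qed
  qed simp
  also have "\<dots> = (\<integral>\<^sup>+t. (\<Sum>k\<in>F. ennreal (1 / t) * indicator {x k..d} t) \<partial>lborel)"
    by (subst nn_integral_sum) auto
  also have "\<dots> \<le> disc_N z (z m) d"
    unfolding disc_N_def
  proof (rule nn_integral_mono)
    fix t :: real
    show "(\<Sum>k\<in>F. ennreal (1 / t) * indicator {x k..d} t)
        \<le> (disc_count z (z m) t - 1) / ennreal t * indicator {0..d} t"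
    proof (cases "0 < t \<and> t \<le> d")
      case True
      define A where "A = {k \<in> F. x k \<le> t}"
      have A: "finite A" "m \<notin> A" using F by (auto simp: A_def)
      have "(\<Sum>k\<in>F. ennreal (1 / t) * indicator {x k..d} t) = (\<Sum>k\<in>F. if x k \<le> t then ennreal (1 / t) else 0)"
        using True by (intro sum.cong) (auto simp: indicator_def)
      also have "\<dots> = of_nat (card A) * ennreal (1 / t)"
        using F by (simp add: A_def sum.If_cases Int_def)
      also have "\<dots> = of_nat (card A) / ennreal t"
        using True by (simp add: divide_ennreal_def inverse_ennreal inverse_eq_divide)
      also have "\<dots> \<le> (disc_count z (z m) t - 1) / ennreal t"
      proof (rule divide_right_mono_ennreal)
        have "of_nat (card A) + 1 = emeasure (count_space UNIV) (insert m A)"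
          using A by (simp add: add.commute)
        also have "\<dots> \<le> disc_count z (z m) t"
          unfolding disc_count_def using True by (intro emeasure_mono) (auto simp: A_def x_def)
        finally show "of_nat (card A) \<le> disc_count z (z m) t - 1"
          by (simp add: ennreal_le_minus_iff)
      qed
      finally show ?thesis using True by simp
    next
      case False
      have "(\<Sum>k\<in>F. ennreal (1 / t) * indicator {x k..d} t) = 0"
        using False x by (intro sum.neutral) (force simp: indicator_def)
      thus ?thesis by simp
    qed
  qed
  finally show ?thesis by (simp only: x_def)
qed

lemma ln_ext_le_iff: "0 \<le> x \<Longrightarrow> ln_ext x \<le> ereal c \<longleftrightarrow> x \<le> exp c"
  using ln_le_cancel_iff[of x "exp c"] by (auto simp: ln_ext_def)

text \<open>Any two points of modulus at most 1/10 are close on the scale of the disc used in the crowding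
bound for either of them, so infinitely many such nodes would violate that bound.\<close>
lemma finite_near_center:
  fixes z :: "nat \<Rightarrow> complex"
  assumes inj: "inj z"
    and crowd: "\<And>m F. finite F \<Longrightarrow> m \<notin> F \<Longrightarrow>
      (\<Sum>k\<in>F. max 0 (ln ((1 - cmod (z m)) / 2 / cmod (z k - z m)))) \<le> B m"
  shows "finite {n. cmod (z n) \<le> 1 / 10}"
proof (rule ccontr)
  define S where "S = {n. cmod (z n) \<le> 1 / 10}"
  assume "infinite {n. cmod (z n) \<le> 1 / 10}"
  hence S: "infinite S" by (simp add: S_def)
  then obtain m where m: "m \<in> S" using infinite_imp_nonempty by blast
  have "infinite (S - {m})" using S by simp
  then obtain F where F: "finite F" "card F = nat \<lceil>B m / ln 2\<rceil> + 1" "F \<subseteq> S - {m}"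
    using infinite_arbitrarily_large by blast
  have "real (card F) * ln 2
      \<le> (\<Sum>k\<in>F. max 0 (ln ((1 - cmod (z m)) / 2 / cmod (z k - z m))))"
  proof (rule card_mult_ln2_le_log_sum)
    fix k assume "k \<in> F"
    hence k: "k \<noteq> m" "cmod (z k) \<le> 1 / 10" using F by (auto simp: S_def)
    show "z k \<noteq> z m" using k inj by (auto dest: injD)
    show "2 * cmod (z k - z m) \<le> (1 - cmod (z m)) / 2"
      using norm_triangle_ineq4[of "z k" "z m"] k m by (simp add: S_def)
  qed
  also have "\<dots> \<le> B m" using F by (intro crowd) auto
  finally have "real (card F) \<le> B m / ln 2" by (simp add: le_divide_eq)
  thus False unfolding F(2) by linarith
qed

lemma max_mod_le:
  assumes "0 < r" "\<And>u. cmod u = r \<Longrightarrow> cmod (f u) \<le> B"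
  shows "0 \<le> max_mod r f" "max_mod r f \<le> B"
proof -
  have "cmod (f (of_real r)) \<le> max_mod r f"
    unfolding max_mod_def using assms by (intro cSUP_upper bdd_aboveI2[of _ _ B]) auto
  thus "0 \<le> max_mod r f" by (rule order_trans[OF norm_ge_zero])
  show "max_mod r f \<le> B"
    unfolding max_mod_def
  proof (rule cSUP_least)
    show "sphere (0::complex) r \<noteq> {}" using assms by simp
  qed (use assms in auto)
qed

section \<open>The interpolation theorem\<close>

theorem theorem4:
  fixes z :: "nat \<Rightarrow> complex" and \<psi> :: "real \<Rightarrow> real"
  assumes "inj z"
    and "\<forall>n. z n \<in> ball 0 1"
    and "\<forall>x\<ge>1. \<psi> x > 0"
    and "mono_on {1..} \<psi>"
    and "\<not> bdd_above (\<psi> ` {1..})"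
    and "(\<lambda>x. \<psi> (2 * x)) \<in> O[at_top](\<psi>)"
    and "\<exists>C1>0. \<forall>n. disc_N z (z n) ((1 - cmod (z n)) / 2)
                 \<le> ennreal (C1 * \<psi> (1 / (1 - cmod (z n))))"
  shows "\<forall>b :: nat \<Rightarrow> complex.
           (\<exists>C2>0. \<forall>n. ln_ext (cmod (b n)) \<le> ereal (C2 * log_primitive \<psi> (1 / (1 - cmod (z n)))))
           \<longrightarrow> (\<exists>f C3. f analytic_on ball 0 1 \<and> C3 > 0 \<and> (\<forall>n. f (z n) = b n) \<and>
                 (\<forall>r\<in>{0<..<1}. ln_ext (max_mod r f) \<le> ereal (C3 * log_primitive \<psi> (1 / (1 - r)))))"
proof -
  obtain D q where "doubling_weight \<psi> D q"
    by (rule doubling_weight_of_bigo[OF assms(3,4,6)])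
  then interpret doubling_weight \<psi> D q .
  have disc: "cmod (z n) < 1" for n using assms(2) by simp
  obtain C\<^sub>1 where C1: "0 < C\<^sub>1"
      "\<And>n. disc_N z (z n) ((1 - cmod (z n)) / 2) \<le> ennreal (C\<^sub>1 * \<psi> (1 / (1 - cmod (z n))))"
    using assms(7) by blast
  have crowd: "(\<Sum>k\<in>F. max 0 (ln ((1 - cmod (z m)) / 2 / cmod (z k - z m)))) \<le> C\<^sub>1 * \<psi> (1 / (1 - cmod (z m)))"
    if "finite F" "m \<notin> F" for m F
  proof -
    have "1 \<le> 1 / (1 - cmod (z m))" using disc[of m] by (simp add: le_divide_eq)
    hence "0 \<le> C\<^sub>1 * \<psi> (1 / (1 - cmod (z m)))" using C1(1) psi_pos by (simp add: less_imp_le)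
    moreover have "ennreal (\<Sum>k\<in>F. max 0 (ln ((1 - cmod (z m)) / 2 / cmod (z k - z m))))
        \<le> ennreal (C\<^sub>1 * \<psi> (1 / (1 - cmod (z m))))"
      by (rule order_trans[OF disc_N_ge_log_sum[OF assms(1) that] C1(2)]) (use disc[of m] in simp)
    ultimately show ?thesis by (simp add: ennreal_le_iff)
  qed
  define I where "I = {n. z n \<noteq> 0}"
  obtain \<eta> where \<eta>: "0 < \<eta>" "\<And>n. n \<in> I \<Longrightarrow> \<eta> \<le> cmod (z n)"
  proof -
    define S where "S = insert (1 / 10) ((\<lambda>n. cmod (z n)) ` ({n. cmod (z n) \<le> 1 / 10} \<inter> I))"
    have S: "finite S" using finite_near_center[OF assms(1) crowd] by (simp add: S_def)
    have "0 < Min S" using S by (subst Min_gr_iff) (auto simp: S_def I_def)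
    moreover have "Min S \<le> cmod (z n)" if "n \<in> I" for n
    proof (cases "cmod (z n) \<le> 1 / 10")
      case True
      thus ?thesis using S that by (intro Min_le) (auto simp: S_def)
    next
      case False
      have "Min S \<le> 1 / 10" using S by (intro Min_le) (auto simp: S_def)
      thus ?thesis using False by linarith
    qed
    ultimately show ?thesis by (rule that)
  qed
  interpret sparse_points \<psi> D q z I \<eta> C\<^sub>1
  proof unfold_locales
    fix m F assume "m \<in> I" "finite F" "F \<subseteq> I - {m}"
    thus "(\<Sum>k\<in>F. max 0 (ln ((1 - cmod (z m)) / 2 / cmod (z k - z m)))) \<le> C\<^sub>1 * \<psi> (1 / (1 - cmod (z m)))"
      by (intro crowd) auto
  qed (use disc \<eta> C1(1) assms(1) in \<open>auto intro: inj_on_subset\<close>)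
  show ?thesis
  proof (intro allI impI)
    fix b :: "nat \<Rightarrow> complex"
    assume "\<exists>C2>0. \<forall>n. ln_ext (cmod (b n)) \<le> ereal (C2 * log_primitive \<psi> (1 / (1 - cmod (z n))))"
    then obtain C2 where C2: "0 < C2"
        and b: "\<And>n. cmod (b n) \<le> exp (C2 * log_primitive \<psi> (1 / (1 - cmod (z n))))"
      by (auto simp: ln_ext_le_iff)
    \<comment> \<open>At the origin the growth condition on \<open>b\<close> means \<open>\<bar>b\<bar> \<le> 1\<close>, as the primitive vanishes at 1.\<close>
    obtain \<beta> where \<beta>: "cmod \<beta> \<le> 1" "\<And>n. z n = 0 \<Longrightarrow> b n = \<beta>"
    proof (cases "\<exists>k. z k = 0")
      case True
      then obtain k where k: "z k = 0" by blast
      show ?thesis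
      proof (rule that)
        show "cmod (b k) \<le> 1" using b[of k] k by simp
        show "b n = b k" if "z n = 0" for n
          using injD[OF assms(1), of n k] k that by simp
      qed
    next
      case False
      thus ?thesis using that[of 0] by simp
    qed
    \<comment> \<open>The ansatz \<open>f(u) = \<beta> + u g(u)\<close> settles a node at the origin and forces \<open>\<bar>f(0)\<bar> \<le> 1\<close>, which the
    required bound demands as \<open>r\<close> tends to 0.\<close>
    define a where "a n = (b n - \<beta>) / z n" for n
    define K where "K = C2 + \<bar>ln (2 / \<eta>)\<bar>"
    have K: "0 < K" using C2 by (simp add: K_def add_pos_nonneg)
    have a: "cmod (a n) \<le> exp (K * node_growth n)" if n: "n \<in> I" for n
    proof -
      define L where "L = log_primitive \<psi> (1 / (1 - cmod (z n)))"
      have L: "0 \<le> L"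
        using log_primitive_mono[of 1 "1 / (1 - cmod (z n))"] inverse_gap_ge_1[OF disc[of n]]
        by (simp add: L_def)
      have "cmod (b n - \<beta>) \<le> exp (C2 * L) + 1"
        using norm_triangle_ineq4[of "b n" \<beta>] b[of n] \<beta>(1) by (simp add: L_def)
      also have "\<dots> \<le> 2 * exp (C2 * L)" using C2 L by simp
      finally have "cmod (a n) \<le> 2 * exp (C2 * L) / \<eta>"
        unfolding a_def norm_divide using \<eta>(1) \<eta>(2)[OF n] by (intro frac_le) auto
      also have "\<dots> = exp (ln (2 / \<eta>) + C2 * L)" using \<eta>(1) by (simp add: exp_add)
      also have "\<dots> \<le> exp (K * node_growth n)"
      proof -
        have "ln (2 / \<eta>) \<le> \<bar>ln (2 / \<eta>)\<bar>" "0 \<le> \<bar>ln (2 / \<eta>)\<bar> * L" using L by auto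
        moreover have "K * node_growth n = C2 + C2 * L + \<bar>ln (2 / \<eta>)\<bar> + \<bar>ln (2 / \<eta>)\<bar> * L"
          by (simp add: K_def node_growth_def growth_def distrib_left distrib_right flip: L_def)
        ultimately show ?thesis unfolding exp_le_cancel_iff using C2 by linarith
      qed
      finally show ?thesis .
    qed
    obtain C g where C: "0 < C" and g: "g holomorphic_on ball 0 1" "\<And>n. n \<in> I \<Longrightarrow> g (z n) = a n"
      "\<And>u. u \<in> ball 0 1 \<Longrightarrow> cmod (g u) \<le> exp (C * growth (1 / (1 - cmod u)))"
      using interpolation[OF K, of a] a by metis
    define f where "f u = \<beta> + u * g u" for u
    define C3 where "C3 = C + exp C / \<psi> 1"
    have "f holomorphic_on ball 0 1" unfolding f_def by (intro holomorphic_intros g)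
    hence "f analytic_on ball 0 1" by (simp add: analytic_on_open)
    moreover have "0 < C3" using C psi_pos[of 1] by (simp add: C3_def add_pos_pos)
    moreover have "f (z n) = b n" for n
      using \<beta>(2)[of n] g(2)[of n] by (cases "z n = 0") (auto simp: f_def I_def a_def)
    moreover have "ln_ext (max_mod r f) \<le> ereal (C3 * log_primitive \<psi> (1 / (1 - r)))" if r: "r \<in> {0<..<1}" for r
    proof -
      define L where "L = log_primitive \<psi> (1 / (1 - r))"
      have r1: "1 \<le> 1 / (1 - r)" using r by (simp add: le_divide_eq)
      \<comment> \<open>Since \<open>L\<close> is at least linear in \<open>r\<close>, the factor \<open>r\<close> in front of \<open>g\<close> absorbs the additive constant hidden in
      the growth of \<open>g\<close>.\<close>
      have L: "\<psi> 1 * r \<le> L"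
      proof -
        have "r \<le> ln (1 / (1 - r))"
          using ln_le_minus_one[of "1 - r"] r by (simp add: ln_div)
        hence "\<psi> 1 * r \<le> \<psi> 1 * ln (1 / (1 - r))"
          using psi_pos[of 1] by (intro mult_left_mono) auto
        also have "\<dots> \<le> L" unfolding L_def by (rule log_primitive_ge_ln[OF r1])
        finally show ?thesis .
      qed
      have "0 \<le> \<psi> 1 * r" using psi_pos[of 1] r by simp
      hence L0: "0 \<le> L" using L by linarith
      have "cmod (f u) \<le> exp (C3 * L)" if u: "cmod u = r" for u
      proof -
        have "cmod (f u) \<le> 1 + r * exp (C * (1 + L))"
        proof -
          have "cmod (f u) \<le> cmod \<beta> + r * cmod (g u)"
            unfolding f_def using norm_triangle_ineq[of \<beta> "u * g u"] u by (simp add: norm_mult)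
          also have "\<dots> \<le> 1 + r * exp (C * (1 + L))"
            using \<beta>(1) g(3)[of u] u r by (intro add_mono mult_left_mono) (auto simp: growth_def L_def)
          finally show ?thesis .
        qed
        also have "\<dots> \<le> exp (C * L) + r * exp (C * (1 + L))"
          using C L0 by simp
        also have "\<dots> = exp (C * L) * (1 + exp C * r)"
          by (simp add: distrib_left exp_add)
        also have "\<dots> \<le> exp (C * L) * exp (exp C * r)"
          using exp_ge_add_one_self[of "exp C * r"] by (intro mult_left_mono) auto
        also have "\<dots> = exp (C * L + exp C * r)" by (simp add: exp_add)
        also have "\<dots> \<le> exp (C3 * L)"
        proof -
          have "exp C * r = exp C / \<psi> 1 * (\<psi> 1 * r)" using psi_pos[of 1] by simp
          also have "\<dots> \<le> exp C / \<psi> 1 * L" using L psi_pos[of 1] by (intro mult_left_mono) auto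
          finally show ?thesis by (simp add: C3_def distrib_right)
        qed
        finally show ?thesis .
      qed
      from max_mod_le[OF _ this] r have "0 \<le> max_mod r f" "max_mod r f \<le> exp (C3 * L)" by auto
      thus ?thesis by (simp add: ln_ext_le_iff L_def)
    qed
    ultimately show "\<exists>f C3. f analytic_on ball 0 1 \<and> C3 > 0 \<and> (\<forall>n. f (z n) = b n) \<and>
        (\<forall>r\<in>{0<..<1}. ln_ext (max_mod r f) \<le> ereal (C3 * log_primitive \<psi> (1 / (1 - r))))"
      by blast
  qed
qed

end
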